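(* There exists a universal constant $c>0$ such that the following holds. Let $n,d$ be positive integers, $S\subset[d]$ with $s=|S|$, $V>0$, $\sigma>0$, and set $V_S=V/n^{d-s}$, $\sigma_S^2=\sigma^2/n^{d-s}$. Suppose one observes $y=\theta+\sigma Z$, where $Z$ has independent standard Gaussian entries. If $s\ge 2$, then $$\inf_{\tilde\theta}\sup_{\theta\in K^S_{d,n}(V)}\mathbb{E}_\theta\|\tilde\theta-\theta\|^2\ge c\,n^{d-s}\min\Big\{\frac{\sigma_SV_S}{2s}\sqrt{1+\log\Big(\frac{2\sigma_S\,s\,n^s}{V_S}\Big)},\ n^s\sigma_S^2,\ \Big(\frac{V_S}{s}\Big)^2+\sigma_S^2\Big\}.$$ If $s=1$, then $$\inf_{\tilde\theta}\sup_{\theta\in K^S_{d,n}(V)}\mathbb{E}_\theta\|\tilde\theta-\theta\|^2\ge c\,n^{d-1}\min\big\{(\sigma_S^2V_S)^{2/3}n^{1/3},\ n\sigma_S^2,\ nV_S^2\big\}.$$ Here the infimum is over all estimators $\tilde\theta=\tilde\theta(y)\in\mathbb{R}^{L_{d,n}}$.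
   Context: $L_{d,n}=\{1,\dots,n\}^d$ is regarded as the $d$-dimensional lattice graph (vertices adjacent iff at $\ell_1$-distance 1) with edge set $E_{d,n}$. For $\theta\in\mathbb{R}^{L_{d,n}}$, $\mathrm{TV}(\theta)=\sum_{(u,v)\in E_{d,n}}|\theta_u-\theta_v|$. $\|\cdot\|$ is the Euclidean norm on $\mathbb{R}^{L_{d,n}}$. $K_{d,n}(V)=\{\theta\in\mathbb{R}^{L_{d,n}}:\mathrm{TV}(\theta)\le V\}$. For $S\subset[d]$ and $x\in[n]^d$, $x_S$ is the restriction of $x$ to coordinates in $S$, and $K^S_{d,n}(V)=\{\theta\in K_{d,n}(V):\theta(x)=\theta(x')\text{ for all }x,x'\in[n]^d\text{ with }x_S=x'_S\}$. $\sigma_S>0$ denotes the positive square root of $\sigma_S^2$. *)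

theory Defs
  imports "HOL-Probability.Probability"
begin

text \<open>Vectors indexed by a finite set of lattice points are represented as functions that are
  extensional on that set; lattice points are extensional functions on the coordinates \<open>{1..d}\<close>.\<close>

definition lattice :: "nat \<Rightarrow> nat \<Rightarrow> (nat \<Rightarrow> nat) set" where
  "lattice d n = {1..d} \<rightarrow>\<^sub>E {1..n}"

definition l1_dist :: "nat \<Rightarrow> (nat \<Rightarrow> nat) \<Rightarrow> (nat \<Rightarrow> nat) \<Rightarrow> int" where
  "l1_dist d u v = (\<Sum>i\<in>{1..d}. \<bar>int (u i) - int (v i)\<bar>)"

text \<open>The last condition orients each edge in the direction of its increasing coordinate, so that
  every undirected edge is counted exactly once.\<close>

definition lattice_edges :: "nat \<Rightarrow> nat \<Rightarrow> ((nat \<Rightarrow> nat) \<times> (nat \<Rightarrow> nat)) set" where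
  "lattice_edges d n =
     {(u, v). u \<in> lattice d n \<and> v \<in> lattice d n \<and> l1_dist d u v = 1 \<and> (\<forall>i\<in>{1..d}. u i \<le> v i)}"

definition TV :: "nat \<Rightarrow> nat \<Rightarrow> ((nat \<Rightarrow> nat) \<Rightarrow> real) \<Rightarrow> real" where
  "TV d n \<theta> = (\<Sum>(u, v)\<in>lattice_edges d n. \<bar>\<theta> u - \<theta> v\<bar>)"

definition TV_ball :: "nat \<Rightarrow> nat \<Rightarrow> real \<Rightarrow> ((nat \<Rightarrow> nat) \<Rightarrow> real) set" where
  "TV_ball d n V = {\<theta> \<in> lattice d n \<rightarrow>\<^sub>E UNIV. TV d n \<theta> \<le> V}"

definition TV_ball_on :: "nat \<Rightarrow> nat \<Rightarrow> nat set \<Rightarrow> real \<Rightarrow> ((nat \<Rightarrow> nat) \<Rightarrow> real) set" where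
  "TV_ball_on d n S V =
     {\<theta> \<in> TV_ball d n V. \<forall>x\<in>lattice d n. \<forall>x'\<in>lattice d n.
        restrict x S = restrict x' S \<longrightarrow> \<theta> x = \<theta> x'}"

definition std_gaussian :: "'i set \<Rightarrow> ('i \<Rightarrow> real) measure" where
  "std_gaussian I = (\<Pi>\<^sub>M x\<in>I. density lborel (\<lambda>t. ennreal (std_normal_density t)))"

definition estimators :: "'i set \<Rightarrow> (('i \<Rightarrow> real) \<Rightarrow> ('i \<Rightarrow> real)) set" where
  "estimators I = (\<Pi>\<^sub>M x\<in>I. borel) \<rightarrow>\<^sub>M (\<Pi>\<^sub>M x\<in>I. borel)"

text \<open>Risks take values in the extended nonnegative reals because an arbitrary estimator
  may have infinite risk.\<close>

definition sq_risk :: "'i set \<Rightarrow> real \<Rightarrow> (('i \<Rightarrow> real) \<Rightarrow> ('i \<Rightarrow> real)) \<Rightarrow> ('i \<Rightarrow> real) \<Rightarrow> ennreal" where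
  "sq_risk I \<sigma> est \<theta> =
     (\<integral>\<^sup>+ z. ennreal ((L2_set (\<lambda>x. est (\<lambda>w\<in>I. \<theta> w + \<sigma> * z w) x - \<theta> x) I)\<^sup>2) \<partial>std_gaussian I)"

definition minimax_risk :: "'i set \<Rightarrow> real \<Rightarrow> ('i \<Rightarrow> real) set \<Rightarrow> ennreal" where
  "minimax_risk I \<sigma> K = (INF est\<in>estimators I. SUP \<theta>\<in>K. sq_risk I \<sigma> est \<theta>)"

end

theory Submission
  imports Defs
begin

text \<open>
  The risk is bounded below by the Bayes risk of a product prior. The cells are boxes of side \<open>h\<close> in the
  coordinates of \<open>S\<close>, times everything in the other coordinates. They are grouped into \<open>k\<close> blocks of
  \<open>m\<close> cells, and each block carries one cell of height \<open>a\<close> at a uniformly random position. As long as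
  the squared norm of such a bump is at most \<open>\<sigma>\<^sup>2 ln (m / 8)\<close>, a second moment bound on the likelihood
  ratios shows that the bump cannot be located, so each block contributes a fixed fraction of the
  squared norm of its bump. For \<open>s \<ge> 2\<close> single points (\<open>h = 1\<close>) suffice, and the problem is that of an
  \<open>\<ell>\<^sub>1\<close>-ball of radius \<open>V\<^sub>S / (2 s)\<close> in dimension \<open>n\<^sup>s\<close>. For \<open>s = 1\<close> the width \<open>h\<close> balances bias against
  noise. When the claimed bound is at most a constant times \<open>\<sigma>\<^sup>2\<close>, constant signals already give it.
\<close>

section \<open>Bayes risk of separated Gaussian hypotheses\<close>

lemma normal_density_shift:
  "normal_density \<delta> 1 x = std_normal_density x * exp (\<delta> * x - \<delta>\<^sup>2 / 2)"
  unfolding normal_density_def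
  by (simp add: exp_add[symmetric] power2_eq_square field_simps)

lemma emeasure_std_normal_shift:
  assumes [measurable]: "A \<in> sets borel"
  shows "emeasure (density lborel (\<lambda>t. ennreal (std_normal_density t))) ((\<lambda>t. t + \<delta>) -` A) =
    emeasure (density lborel (\<lambda>t. ennreal (normal_density \<delta> 1 t))) A"
proof -
  have [measurable]: "(\<lambda>t. t + \<delta>) -` A \<in> sets borel"
    using measurable_sets[of "\<lambda>t. t + \<delta>" borel borel A] by simp
  have "emeasure (density lborel (\<lambda>t. ennreal (normal_density \<delta> 1 t))) A =
      (\<integral>\<^sup>+x. ennreal (normal_density \<delta> 1 x) * indicator A x \<partial>lborel)"
    by (subst emeasure_density) auto
  also have "\<dots> = (\<integral>\<^sup>+x. ennreal (normal_density \<delta> 1 (\<delta> + 1 * x)) * indicator A (\<delta> + 1 * x) \<partial>lborel)"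
    by (subst nn_integral_real_affine[where c = 1 and t = \<delta>]) auto
  also have "\<dots> = (\<integral>\<^sup>+x. ennreal (std_normal_density x) * indicator ((\<lambda>t. t + \<delta>) -` A) x \<partial>lborel)"
    by (intro nn_integral_cong) (auto simp: normal_density_def indicator_def add.commute)
  finally show ?thesis
    by (subst emeasure_density) auto
qed

lemma sets_std_gaussian [measurable_cong]: "sets (std_gaussian I) = sets (\<Pi>\<^sub>M x\<in>I. borel)"
  unfolding std_gaussian_def by (intro sets_PiM_cong) auto

lemma prob_space_std_gaussian: "prob_space (std_gaussian I)"
  unfolding std_gaussian_def by (intro prob_space_PiM prob_space_normal_density) simp

text \<open>The law of the shifted noise and the law with the exponential density both give every
  box the product of the masses under \<open>normal_density (\<delta> i) 1\<close>, so both equal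
  that product measure. This Cameron-Martin formula puts all hypotheses on one probability
  space.\<close>

lemma nn_integral_std_gaussian_shift:
  fixes \<delta> :: "'i \<Rightarrow> real"
  assumes fin: "finite I" and G[measurable]: "G \<in> borel_measurable (\<Pi>\<^sub>M x\<in>I. borel)"
  shows "(\<integral>\<^sup>+z. G (\<lambda>i\<in>I. z i + \<delta> i) \<partial>std_gaussian I) =
    (\<integral>\<^sup>+z. ennreal (exp ((\<Sum>i\<in>I. \<delta> i * z i) - (\<Sum>i\<in>I. (\<delta> i)\<^sup>2) / 2)) * G z \<partial>std_gaussian I)"
proof -
  let ?B = "\<Pi>\<^sub>M x\<in>I. borel :: real measure"
  define N where "N = density lborel (\<lambda>t. ennreal (std_normal_density t))"
  define M where "M i = density lborel (\<lambda>t. ennreal (normal_density (\<delta> i) 1 t))" for i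
  define L where "L z = exp ((\<Sum>i\<in>I. \<delta> i * z i) - (\<Sum>i\<in>I. (\<delta> i)\<^sup>2) / 2)" for z :: "'i \<Rightarrow> real"
  have gauss: "std_gaussian I = (\<Pi>\<^sub>M x\<in>I. N)"
    by (simp add: std_gaussian_def N_def)
  have [measurable_cong, simp]: "sets N = sets borel" "\<And>i. sets (M i) = sets borel"
    by (auto simp: N_def M_def)
  have spN [simp]: "space N = UNIV" by (simp add: N_def)
  have pN: "prob_space N" unfolding N_def by (rule prob_space_normal_density) simp
  have pM: "prob_space (M i)" for i unfolding M_def by (rule prob_space_normal_density) simp
  interpret PN: product_sigma_finite "\<lambda>_::'i. N"
    by (intro product_sigma_finite.intro prob_space_imp_sigma_finite pN)
  interpret PM: product_sigma_finite M
    by (intro product_sigma_finite.intro prob_space_imp_sigma_finite pM)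
  have L[measurable]: "L \<in> borel_measurable ?B"
    unfolding L_def by measurable
  have sB: "sets (PiM I M) = sets ?B" "sets (\<Pi>\<^sub>M x\<in>I. N) = sets ?B"
    by (auto intro!: sets_PiM_cong)
  note [measurable_cong] = sB
  have shift[measurable]: "(\<lambda>z. \<lambda>i\<in>I. z i + \<delta> i) \<in> (\<Pi>\<^sub>M x\<in>I. N) \<rightarrow>\<^sub>M ?B"
    by measurable
  have 1: "distr (\<Pi>\<^sub>M x\<in>I. N) ?B (\<lambda>z. \<lambda>i\<in>I. z i + \<delta> i) = PiM I M"
  proof (rule PM.PiM_eqI[OF fin])
    fix A assume "\<And>i. i \<in> I \<Longrightarrow> A i \<in> sets (M i)"
    then have A[measurable]: "\<And>i. i \<in> I \<Longrightarrow> A i \<in> sets borel" by simp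
    have box: "Pi\<^sub>E I A \<in> sets ?B" using A fin by (intro sets_PiM_I_finite) auto
    have "emeasure (distr (\<Pi>\<^sub>M x\<in>I. N) ?B (\<lambda>z. \<lambda>i\<in>I. z i + \<delta> i)) (Pi\<^sub>E I A) =
        emeasure (\<Pi>\<^sub>M x\<in>I. N) ((\<lambda>z. \<lambda>i\<in>I. z i + \<delta> i) -` Pi\<^sub>E I A \<inter> space (\<Pi>\<^sub>M x\<in>I. N))"
      by (rule emeasure_distr[OF shift box])
    also have "(\<lambda>z. \<lambda>i\<in>I. z i + \<delta> i) -` Pi\<^sub>E I A \<inter> space (\<Pi>\<^sub>M x\<in>I. N) =
        (\<Pi>\<^sub>E i\<in>I. (\<lambda>t. t + \<delta> i) -` A i)"
      by (auto simp: space_PiM PiE_iff)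
    also have "emeasure (\<Pi>\<^sub>M x\<in>I. N) \<dots> = (\<Prod>i\<in>I. emeasure N ((\<lambda>t. t + \<delta> i) -` A i))"
    proof (rule PN.emeasure_PiM[OF fin])
      show "(\<lambda>t. t + \<delta> i) -` A i \<in> sets N" if "i \<in> I" for i
        using measurable_sets[of "\<lambda>t. t + \<delta> i" borel borel "A i"] A[OF that] by simp
    qed
    also have "\<dots> = (\<Prod>i\<in>I. emeasure (M i) (A i))"
      unfolding N_def M_def by (intro prod.cong refl emeasure_std_normal_shift A)
    finally show "emeasure (distr (\<Pi>\<^sub>M x\<in>I. N) ?B (\<lambda>z. \<lambda>i\<in>I. z i + \<delta> i)) (Pi\<^sub>E I A) =
        (\<Prod>i\<in>I. emeasure (M i) (A i))" .
  qed (simp add: sB)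
  have 2: "density (\<Pi>\<^sub>M x\<in>I. N) (\<lambda>z. ennreal (L z)) = PiM I M"
  proof (rule PM.PiM_eqI[OF fin])
    fix A assume "\<And>i. i \<in> I \<Longrightarrow> A i \<in> sets (M i)"
    then have A[measurable]: "\<And>i. i \<in> I \<Longrightarrow> A i \<in> sets borel" by simp
    have box: "Pi\<^sub>E I A \<in> sets (\<Pi>\<^sub>M x\<in>I. N)" using A fin by (intro sets_PiM_I_finite) auto
    have L_prod: "ennreal (L z) = (\<Prod>i\<in>I. ennreal (exp (\<delta> i * z i - (\<delta> i)\<^sup>2 / 2)))" for z
      by (simp add: L_def prod_ennreal exp_sum[OF fin, symmetric] sum_subtractf sum_divide_distrib)
    have "emeasure (density (\<Pi>\<^sub>M x\<in>I. N) (\<lambda>z. ennreal (L z))) (Pi\<^sub>E I A) =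
        (\<integral>\<^sup>+z. ennreal (L z) * indicator (Pi\<^sub>E I A) z \<partial>(\<Pi>\<^sub>M x\<in>I. N))"
      using box by (subst emeasure_density) auto
    also have "\<dots> = (\<integral>\<^sup>+z. (\<Prod>i\<in>I. ennreal (exp (\<delta> i * z i - (\<delta> i)\<^sup>2 / 2)) * indicator (A i) (z i)) \<partial>(\<Pi>\<^sub>M x\<in>I. N))"
    proof (intro nn_integral_cong)
      fix z assume "z \<in> space (\<Pi>\<^sub>M x\<in>I. N)"
      \<comment> \<open>Points of the product space are extensional, so lying in the box is a
        condition on the coordinates in \<open>I\<close> alone.\<close>
      then have "z \<in> extensional I" by (simp add: space_PiM PiE_iff)
      then have "indicator (Pi\<^sub>E I A) z = (\<Prod>i\<in>I. indicator (A i) (z i) :: ennreal)"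
        using fin by (auto simp: indicator_def PiE_iff prod_zero_iff split: if_splits)
      then show "ennreal (L z) * indicator (Pi\<^sub>E I A) z =
          (\<Prod>i\<in>I. ennreal (exp (\<delta> i * z i - (\<delta> i)\<^sup>2 / 2)) * indicator (A i) (z i))"
        by (simp add: prod.distrib L_prod)
    qed
    also have "\<dots> = (\<Prod>i\<in>I. \<integral>\<^sup>+x. ennreal (exp (\<delta> i * x - (\<delta> i)\<^sup>2 / 2)) * indicator (A i) x \<partial>N)"
      using A by (intro PN.product_nn_integral_prod fin) measurable
    also have "\<dots> = (\<Prod>i\<in>I. emeasure (M i) (A i))"
    proof (intro prod.cong refl)
      fix i assume "i \<in> I"
      note A[OF this, measurable]
      show "(\<integral>\<^sup>+x. ennreal (exp (\<delta> i * x - (\<delta> i)\<^sup>2 / 2)) * indicator (A i) x \<partial>N) = emeasure (M i) (A i)"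
        unfolding N_def M_def
        by (subst emeasure_density, simp, simp, subst nn_integral_density)
           (auto intro!: nn_integral_cong simp: normal_density_shift[of "\<delta> i"] ennreal_mult' mult.assoc)
    qed
    finally show "emeasure (density (\<Pi>\<^sub>M x\<in>I. N) (\<lambda>z. ennreal (L z))) (Pi\<^sub>E I A) =
        (\<Prod>i\<in>I. emeasure (M i) (A i))" .
  qed (simp add: sB)
  have "(\<integral>\<^sup>+z. G (\<lambda>i\<in>I. z i + \<delta> i) \<partial>(\<Pi>\<^sub>M x\<in>I. N)) =
      (\<integral>\<^sup>+z. G z \<partial>distr (\<Pi>\<^sub>M x\<in>I. N) ?B (\<lambda>z. \<lambda>i\<in>I. z i + \<delta> i))"
    by (subst nn_integral_distr) auto
  also have "\<dots> = (\<integral>\<^sup>+z. G z \<partial>density (\<Pi>\<^sub>M x\<in>I. N) (\<lambda>z. ennreal (L z)))"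
    by (simp add: 1 2)
  also have "\<dots> = (\<integral>\<^sup>+z. ennreal (L z) * G z \<partial>(\<Pi>\<^sub>M x\<in>I. N))"
    by (subst nn_integral_density) auto
  finally show ?thesis
    by (simp add: gauss L_def)
qed

text \<open>With \<open>W\<close> the sum of the weights, the left side exceeds the first sum on the right by at most
  \<open>D / 4\<close> times \<open>(\<Sum>j\<in>J. (w j)\<^sup>2) / W\<close>, which is at most \<open>2 (\<Sum>j\<in>J. (w j)\<^sup>2)\<close> if \<open>W \<ge> 1 / 2\<close>; the
  constant \<open>1 / 2\<close> covers small \<open>W\<close>. In this form only first and second moments of the weights are needed.\<close>

lemma weighted_separation_bound:
  fixes w :: "'j \<Rightarrow> real" and \<theta> :: "'j \<Rightarrow> 'i \<Rightarrow> real"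
  assumes "finite J" and w: "\<And>j. j \<in> J \<Longrightarrow> w j \<ge> 0" and "D \<ge> 0"
    and sep: "\<And>i j. i \<in> J \<Longrightarrow> j \<in> J \<Longrightarrow> i \<noteq> j \<Longrightarrow> D \<le> (\<Sum>x\<in>B. (\<theta> i x - \<theta> j x)\<^sup>2)"
  shows "D / 4 * (\<Sum>j\<in>J. w j) \<le>
    (\<Sum>j\<in>J. w j * (\<Sum>x\<in>B. (e x - \<theta> j x)\<^sup>2)) + D / 4 * (1 / 2 + 2 * (\<Sum>j\<in>J. (w j)\<^sup>2))"
proof -
  define q where "q j = (\<Sum>x\<in>B. (e x - \<theta> j x)\<^sup>2)" for j
  define W where "W = (\<Sum>j\<in>J. w j)"
  define Q where "Q = (\<Sum>j\<in>J. w j * q j)"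
  define T where "T = (\<Sum>j\<in>J. (w j)\<^sup>2)"
  have W0: "W \<ge> 0" unfolding W_def using w by (intro sum_nonneg)
  have T0: "T \<ge> 0" unfolding T_def by (intro sum_nonneg) simp
  have Q0: "Q \<ge> 0" unfolding Q_def q_def using w by (intro sum_nonneg mult_nonneg_nonneg) auto
  \<comment> \<open>Separated hypotheses cannot both be close to \<open>e\<close>. The factor that
    vanishes for \<open>i = j\<close> keeps the bound valid on the diagonal, where nothing is
    separated.\<close>
  have q: "D * (if i = j then 0 else 1) \<le> 2 * q i + 2 * q j" if "i \<in> J" "j \<in> J" for i j
  proof (cases "i = j")
    case True
    then show ?thesis by (simp add: q_def sum_nonneg)
  next
    case False
    \<comment> \<open>The difference of the two sides is the square of
      \<open>(e x - \<theta> i x) + (e x - \<theta> j x)\<close>.\<close>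
    have "(\<theta> i x - \<theta> j x)\<^sup>2 \<le> 2 * (e x - \<theta> i x)\<^sup>2 + 2 * (e x - \<theta> j x)\<^sup>2" for x
      using sum_squares_ge_zero[of "(e x - \<theta> i x) + (e x - \<theta> j x)" 0]
      by (simp add: power2_eq_square algebra_simps)
    then have "(\<Sum>x\<in>B. (\<theta> i x - \<theta> j x)\<^sup>2) \<le> 2 * q i + 2 * q j"
      unfolding q_def sum_distrib_left sum.distrib[symmetric] by (intro sum_mono)
    with sep[OF that False] False show ?thesis by simp
  qed
  have "D * (W\<^sup>2 - T) = (\<Sum>i\<in>J. \<Sum>j\<in>J. w i * w j * (D * (if i = j then 0 else 1)))"
  proof -
    have "(\<Sum>i\<in>J. \<Sum>j\<in>J. w i * w j * (D * (if i = j then 0 else 1))) =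
        (\<Sum>i\<in>J. \<Sum>j\<in>J. D * (w i * w j) - (if i = j then D * (w i * w j) else 0))"
      by (intro sum.cong refl) auto
    also have "\<dots> = D * (W * W) - (\<Sum>i\<in>J. D * (w i)\<^sup>2)"
      using \<open>finite J\<close>
      by (simp add: sum_subtractf W_def sum_product sum_distrib_left[symmetric] power2_eq_square)
    finally show ?thesis
      by (simp add: T_def sum_distrib_left[symmetric] power2_eq_square algebra_simps)
  qed
  also have "\<dots> \<le> (\<Sum>i\<in>J. \<Sum>j\<in>J. w i * w j * (2 * q i + 2 * q j))"
    using q w by (intro sum_mono mult_left_mono) auto
  also have "\<dots> = 2 * (\<Sum>i\<in>J. \<Sum>j\<in>J. (w i * q i) * w j) + 2 * (\<Sum>i\<in>J. \<Sum>j\<in>J. w i * (w j * q j))"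
    by (simp add: sum_distrib_left sum.distrib algebra_simps)
  also have "\<dots> = 4 * W * Q"
    by (simp add: sum_product[symmetric] W_def Q_def)
  finally have main: "D * (W\<^sup>2 - T) \<le> 4 * W * Q" .
  have "D / 4 * W \<le> Q + D / 4 * (1 / 2 + 2 * T)"
  proof (cases "W \<le> 1 / 2")
    case True
    then have "D / 4 * W \<le> D / 4 * (1 / 2 + 2 * T)"
      using T0 \<open>D \<ge> 0\<close> by (intro mult_left_mono) auto
    with Q0 show ?thesis by linarith
  next
    case False
    have "D / 4 * (W * W) \<le> W * Q + D / 4 * T"
      using main by (simp add: power2_eq_square algebra_simps)
    also have "\<dots> \<le> W * Q + D / 4 * ((1 / 2 + 2 * T) * W)"
    proof -
      have "T * 1 \<le> T * (2 * W)"
        using False T0 by (intro mult_left_mono) auto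
      then have "T \<le> (1 / 2 + 2 * T) * W"
        using W0 by (simp add: algebra_simps)
      then show ?thesis
        using \<open>D \<ge> 0\<close> by (intro add_left_mono mult_left_mono) auto
    qed
    finally have "W * (D / 4 * W) \<le> W * (Q + D / 4 * (1 / 2 + 2 * T))"
      by (simp add: algebra_simps)
    with False show ?thesis by simp
  qed
  then show ?thesis by (simp add: W_def Q_def T_def q_def)
qed

text \<open>Take the likelihood ratios against the centre \<open>\<theta>0\<close>, divided by
  \<open>m = card J\<close>, as weights in \<open>weighted_separation_bound\<close>. Their sum has
  mean 1, and by \<open>near\<close> the sum of their squares has mean at most 1/8, so
  \<open>D / 4 * (1 - 1/2 - 2/8) = D / 16\<close> is left. Closeness is measured on
  \<open>I\<close>, as it concerns the law of the whole observation; the loss is measured on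
  \<open>B\<close>, so that losses on disjoint blocks can be added.\<close>

lemma separated_hypotheses_risk:
  fixes \<theta> :: "'j \<Rightarrow> 'i \<Rightarrow> real"
  assumes fin: "finite I" and B: "B \<subseteq> I" and J: "finite J" "J \<noteq> {}" and \<sigma>: "\<sigma> > 0" and D: "D \<ge> 0"
    and est: "est \<in> estimators I"
    and near: "\<And>j. j \<in> J \<Longrightarrow> (\<Sum>x\<in>I. (\<theta> j x - \<theta>0 x)\<^sup>2) \<le> \<sigma>\<^sup>2 * ln (real (card J) / 8)"
    and sep: "\<And>i j. i \<in> J \<Longrightarrow> j \<in> J \<Longrightarrow> i \<noteq> j \<Longrightarrow> D \<le> (\<Sum>x\<in>B. (\<theta> i x - \<theta> j x)\<^sup>2)"
  shows "ennreal (real (card J) * (D / 16)) \<le>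
    (\<Sum>j\<in>J. \<integral>\<^sup>+z. ennreal (\<Sum>x\<in>B. (est (\<lambda>w\<in>I. \<theta> j w + \<sigma> * z w) x - \<theta> j x)\<^sup>2) \<partial>std_gaussian I)"
proof -
  interpret prob_space "std_gaussian I" by (rule prob_space_std_gaussian)
  note est[unfolded estimators_def, measurable]
  define m where "m = real (card J)"
  have m: "m > 0" using J by (simp add: m_def card_gt_0_iff)
  define \<delta> where "\<delta> j x = (\<theta> j x - \<theta>0 x) / \<sigma>" for j x
  define L where "L j z = exp ((\<Sum>i\<in>I. \<delta> j i * z i) - (\<Sum>i\<in>I. (\<delta> j i)\<^sup>2) / 2)" for j z
  define q where "q j z = (\<Sum>x\<in>B. (est (\<lambda>w\<in>I. \<theta>0 w + \<sigma> * z w) x - \<theta> j x)\<^sup>2)" for j z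
  have [measurable]: "L j \<in> borel_measurable (\<Pi>\<^sub>M x\<in>I. borel)" for j
    unfolding L_def by measurable
  have [measurable]: "(\<lambda>z. est (\<lambda>w\<in>I. \<theta>0 w + \<sigma> * z w) x) \<in> borel_measurable (\<Pi>\<^sub>M x\<in>I. borel)" if "x \<in> I" for x
    using that by measurable
  have q_meas[measurable]: "q j \<in> borel_measurable (\<Pi>\<^sub>M x\<in>I. borel)" for j
    unfolding q_def using B by (intro borel_measurable_sum borel_measurable_power borel_measurable_diff) auto
  have risk: "(\<integral>\<^sup>+z. ennreal (\<Sum>x\<in>B. (est (\<lambda>w\<in>I. \<theta> j w + \<sigma> * z w) x - \<theta> j x)\<^sup>2) \<partial>std_gaussian I) =
      (\<integral>\<^sup>+z. ennreal (L j z * q j z) \<partial>std_gaussian I)" for j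
  proof -
    \<comment> \<open>Shifting the noise by \<open>\<delta> j\<close> moves the mean from
      \<open>\<theta>0\<close> to \<open>\<theta> j\<close>, so each risk becomes a weighted
      integral under the centre.\<close>
    have "(\<lambda>w\<in>I. \<theta> j w + \<sigma> * z w) = (\<lambda>w\<in>I. \<theta>0 w + \<sigma> * (\<lambda>i\<in>I. z i + \<delta> j i) w)" for z
      using \<sigma> by (auto simp: \<delta>_def field_simps)
    then have "(\<integral>\<^sup>+z. ennreal (\<Sum>x\<in>B. (est (\<lambda>w\<in>I. \<theta> j w + \<sigma> * z w) x - \<theta> j x)\<^sup>2) \<partial>std_gaussian I) =
        (\<integral>\<^sup>+z. ennreal (q j (\<lambda>i\<in>I. z i + \<delta> j i)) \<partial>std_gaussian I)"
      unfolding q_def by simp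
    also have "\<dots> = (\<integral>\<^sup>+z. ennreal (L j z) * ennreal (q j z) \<partial>std_gaussian I)"
      unfolding L_def by (rule nn_integral_std_gaussian_shift[OF fin]) measurable
    finally show ?thesis
      by (simp add: ennreal_mult' L_def)
  qed
  have L1: "(\<integral>\<^sup>+z. ennreal (exp ((\<Sum>i\<in>I. d i * z i) - (\<Sum>i\<in>I. (d i)\<^sup>2) / 2)) \<partial>std_gaussian I) = 1" for d
    using nn_integral_std_gaussian_shift[OF fin, of "\<lambda>_. 1" d] by (simp add: emeasure_space_1)
  have L2: "(\<integral>\<^sup>+z. ennreal ((L j z)\<^sup>2) \<partial>std_gaussian I) \<le> ennreal (m / 8)" if j: "j \<in> J" for j
  proof -
    \<comment> \<open>Squaring a likelihood ratio doubles the shift: up to a constant factor the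
      result is the ratio for \<open>2 * \<delta> j\<close>, whose integral is 1.\<close>
    have "(L j z)\<^sup>2 = exp (\<Sum>i\<in>I. (\<delta> j i)\<^sup>2) *
        exp ((\<Sum>i\<in>I. (2 * \<delta> j i) * z i) - (\<Sum>i\<in>I. (2 * \<delta> j i)\<^sup>2) / 2)" for z
    proof -
      have "(\<Sum>i\<in>I. (2 * \<delta> j i) * z i) = 2 * (\<Sum>i\<in>I. \<delta> j i * z i)"
        "(\<Sum>i\<in>I. (2 * \<delta> j i)\<^sup>2) = 4 * (\<Sum>i\<in>I. (\<delta> j i)\<^sup>2)"
        by (simp_all add: sum_distrib_left power_mult_distrib mult.assoc)
      then show ?thesis
        by (simp add: L_def exp_add[symmetric] exp_double[symmetric] right_diff_distrib)
    qed
    then have "(\<integral>\<^sup>+z. ennreal ((L j z)\<^sup>2) \<partial>std_gaussian I) = ennreal (exp (\<Sum>i\<in>I. (\<delta> j i)\<^sup>2))"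
      using L1[of "\<lambda>i. 2 * \<delta> j i"] by (simp add: ennreal_mult' nn_integral_cmult)
    also have "exp (\<Sum>i\<in>I. (\<delta> j i)\<^sup>2) \<le> m / 8"
    proof -
      have "(\<Sum>i\<in>I. (\<delta> j i)\<^sup>2) = (\<Sum>x\<in>I. (\<theta> j x - \<theta>0 x)\<^sup>2) / \<sigma>\<^sup>2"
        by (simp add: \<delta>_def power_divide sum_divide_distrib)
      also have "\<dots> \<le> ln (m / 8)"
        using near[OF j] \<sigma> by (simp add: m_def field_simps)
      finally show ?thesis using m by (simp add: ln_ge_iff)
    qed
    finally show ?thesis by (simp add: ennreal_leI)
  qed
  have pw: "D / 4 * (\<Sum>j\<in>J. L j z) \<le> (\<Sum>j\<in>J. L j z * q j z) + D / 4 * (m / 2 + 2 / m * (\<Sum>j\<in>J. (L j z)\<^sup>2))" for z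
  proof -
    have "D / 4 * (\<Sum>j\<in>J. L j z / m) \<le> (\<Sum>j\<in>J. L j z / m * q j z) + D / 4 * (1 / 2 + 2 * (\<Sum>j\<in>J. (L j z / m)\<^sup>2))"
      unfolding q_def using J D sep m by (intro weighted_separation_bound) (auto simp: L_def)
    then have "m * (D / 4 * (\<Sum>j\<in>J. L j z / m)) \<le>
       m * ((\<Sum>j\<in>J. L j z / m * q j z) + D / 4 * (1 / 2 + 2 * (\<Sum>j\<in>J. (L j z / m)\<^sup>2)))"
      using m by (intro mult_left_mono) auto
    then show ?thesis
      using m by (simp add: sum_divide_distrib[symmetric] sum_distrib_left[symmetric] power_divide
        distrib_left power2_eq_square)
  qed
  have "ennreal (D / 4 * m) = (\<integral>\<^sup>+z. ennreal (D / 4 * (\<Sum>j\<in>J. L j z)) \<partial>std_gaussian I)"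
  proof -
    have "(\<integral>\<^sup>+z. ennreal (D / 4 * (\<Sum>j\<in>J. L j z)) \<partial>std_gaussian I) =
       (\<integral>\<^sup>+z. ennreal (D / 4) * (\<Sum>j\<in>J. ennreal (L j z)) \<partial>std_gaussian I)"
      using D by (intro nn_integral_cong) (subst ennreal_mult', auto simp: sum_ennreal L_def)
    also have "\<dots> = ennreal (D / 4) * (\<Sum>j\<in>J. \<integral>\<^sup>+z. ennreal (L j z) \<partial>std_gaussian I)"
      by (simp add: nn_integral_cmult nn_integral_sum)
    also have "\<dots> = ennreal (D / 4) * (\<Sum>j\<in>J. 1)"
      using L1 by (simp add: L_def)
    finally show ?thesis
      using D by (simp add: m_def ennreal_mult'[symmetric] ennreal_of_nat_eq_real_of_nat)
  qed
  also have "\<dots> \<le> (\<integral>\<^sup>+z. ennreal ((\<Sum>j\<in>J. L j z * q j z) + D / 4 * (m / 2 + 2 / m * (\<Sum>j\<in>J. (L j z)\<^sup>2))) \<partial>std_gaussian I)"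
    by (intro nn_integral_mono ennreal_leI pw)
  also have "\<dots> = (\<integral>\<^sup>+z. (\<Sum>j\<in>J. ennreal (L j z * q j z)) + (ennreal (D * m / 8) + ennreal (D / (2 * m)) * (\<Sum>j\<in>J. ennreal ((L j z)\<^sup>2))) \<partial>std_gaussian I)"
  proof (intro nn_integral_cong)
    fix z
    have "(\<Sum>j\<in>J. L j z * q j z) \<ge> 0"
      by (intro sum_nonneg mult_nonneg_nonneg) (auto simp: L_def q_def intro!: sum_nonneg)
    moreover have "D / 4 * (m / 2 + 2 / m * (\<Sum>j\<in>J. (L j z)\<^sup>2)) = D * m / 8 + D / (2 * m) * (\<Sum>j\<in>J. (L j z)\<^sup>2)"
      by (simp add: field_simps)
    ultimately show "ennreal ((\<Sum>j\<in>J. L j z * q j z) + D / 4 * (m / 2 + 2 / m * (\<Sum>j\<in>J. (L j z)\<^sup>2))) =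
      (\<Sum>j\<in>J. ennreal (L j z * q j z)) + (ennreal (D * m / 8) + ennreal (D / (2 * m)) * (\<Sum>j\<in>J. ennreal ((L j z)\<^sup>2)))"
      using D m
      by (simp add: sum_ennreal L_def q_def sum_nonneg ennreal_mult'[symmetric] ennreal_plus[symmetric] del: ennreal_plus)
  qed
  also have "\<dots> = (\<Sum>j\<in>J. \<integral>\<^sup>+z. ennreal (L j z * q j z) \<partial>std_gaussian I) +
      (ennreal (D * m / 8) + ennreal (D / (2 * m)) * (\<Sum>j\<in>J. \<integral>\<^sup>+z. ennreal ((L j z)\<^sup>2) \<partial>std_gaussian I))"
    by (simp add: nn_integral_add nn_integral_sum nn_integral_cmult emeasure_space_1 del: sum_ennreal)
  also have "\<dots> \<le> (\<Sum>j\<in>J. \<integral>\<^sup>+z. ennreal (L j z * q j z) \<partial>std_gaussian I) +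
      (ennreal (D * m / 8) + ennreal (D / (2 * m)) * (\<Sum>j\<in>J. ennreal (m / 8)))"
    by (intro add_left_mono mult_left_mono sum_mono L2) auto
  also have "(ennreal (D * m / 8) + ennreal (D / (2 * m)) * (\<Sum>j\<in>J. ennreal (m / 8))) = ennreal (3 / 16 * D * m)"
  proof -
    have "(\<Sum>j\<in>J. ennreal (m / 8)) = ennreal (m * (m / 8))"
      using m by (subst sum_ennreal) (auto simp: m_def)
    then have "ennreal (D * m / 8) + ennreal (D / (2 * m)) * (\<Sum>j\<in>J. ennreal (m / 8)) =
        ennreal (D * m / 8 + D / (2 * m) * (m * (m / 8)))"
      using D m by (simp add: ennreal_mult'[symmetric] ennreal_plus[symmetric] del: ennreal_plus)
    also have "D * m / 8 + D / (2 * m) * (m * (m / 8)) = 3 / 16 * D * m"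
      using m by (simp add: field_simps)
    finally show ?thesis .
  qed
  \<comment> \<open>Of the 4/16 of \<open>D * m\<close> the error takes 3/16. It is moved to the
    left side, since a finite summand can be cancelled in \<open>ennreal\<close>.\<close>
  finally have "ennreal (m * (D / 16)) + ennreal (3 / 16 * D * m) \<le>
      (\<Sum>j\<in>J. \<integral>\<^sup>+z. ennreal (L j z * q j z) \<partial>std_gaussian I) + ennreal (3 / 16 * D * m)"
    using D m by (simp add: ennreal_plus[symmetric] field_simps del: ennreal_plus)
  then have "ennreal (m * (D / 16)) \<le> (\<Sum>j\<in>J. \<integral>\<^sup>+z. ennreal (L j z * q j z) \<partial>std_gaussian I)"
    by (simp add: ennreal_add_left_cancel_le add.commute)
  then show ?thesis by (simp add: risk m_def)
qed

section \<open>Averages over finite and product priors\<close>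

lemma minimax_risk_ge_average:
  assumes F: "finite F" "F \<noteq> {}" and K: "\<And>f. f \<in> F \<Longrightarrow> \<theta> f \<in> K" and c: "c \<ge> 0"
    and avg: "\<And>est. est \<in> estimators I \<Longrightarrow> ennreal (real (card F) * c) \<le> (\<Sum>f\<in>F. sq_risk I \<sigma> est (\<theta> f))"
  shows "ennreal c \<le> minimax_risk I \<sigma> K"
  unfolding minimax_risk_def
proof (rule INF_greatest)
  fix est assume est: "est \<in> estimators I"
  let ?m = "real (card F)"
  have m: "?m > 0" using F by (simp add: card_gt_0_iff)
  have "ennreal ?m * ennreal c \<le> (\<Sum>f\<in>F. sq_risk I \<sigma> est (\<theta> f))"
    using avg[OF est] by (simp add: ennreal_mult')
  also have "\<dots> \<le> (\<Sum>f\<in>F. SUP \<theta>\<in>K. sq_risk I \<sigma> est \<theta>)"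
    by (intro sum_mono SUP_upper K)
  also have "\<dots> = ennreal ?m * (SUP \<theta>\<in>K. sq_risk I \<sigma> est \<theta>)"
    by (simp add: ennreal_of_nat_eq_real_of_nat)
  finally show "ennreal c \<le> (SUP \<theta>\<in>K. sq_risk I \<sigma> est \<theta>)"
    using m by (subst (asm) ennreal_mult_le_mult_iff) auto
qed

text \<open>Fixing the choices in all blocks but \<open>b\<close> leaves \<open>card J\<close>
  hypotheses that differ only through \<open>\<phi> b\<close>, so
  \<open>separated_hypotheses_risk\<close> applies with the sum over the other blocks as centre. The
  sets \<open>B b\<close> are disjoint, so the block losses add up to at most the total
  loss.\<close>

lemma minimax_risk_ge_product_prior:
  fixes \<phi> :: "'b \<Rightarrow> 'j \<Rightarrow> 'i \<Rightarrow> real"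
  assumes fin: "finite I" and \<sigma>: "\<sigma> > 0" and D: "D \<ge> 0"
    and P: "finite P" and J: "finite J" "J \<noteq> {}"
    and sub: "\<And>b. b \<in> P \<Longrightarrow> B b \<subseteq> I" and disj: "disjoint_family_on B P"
    and K: "\<And>f. f \<in> P \<rightarrow>\<^sub>E J \<Longrightarrow> (\<lambda>x\<in>I. \<Sum>b\<in>P. \<phi> b (f b) x) \<in> K"
    and near: "\<And>b j. b \<in> P \<Longrightarrow> j \<in> J \<Longrightarrow> (\<Sum>x\<in>I. (\<phi> b j x)\<^sup>2) \<le> \<sigma>\<^sup>2 * ln (real (card J) / 8)"
    and sep: "\<And>b i j. b \<in> P \<Longrightarrow> i \<in> J \<Longrightarrow> j \<in> J \<Longrightarrow> i \<noteq> j \<Longrightarrow> D \<le> (\<Sum>x\<in>B b. (\<phi> b i x - \<phi> b j x)\<^sup>2)"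
  shows "ennreal (real (card P) * (D / 16)) \<le> minimax_risk I \<sigma> K"
proof (rule minimax_risk_ge_average[where F = "P \<rightarrow>\<^sub>E J" and \<theta> = "\<lambda>f. \<lambda>x\<in>I. \<Sum>b\<in>P. \<phi> b (f b) x"])
  show "finite (P \<rightarrow>\<^sub>E J)" "P \<rightarrow>\<^sub>E J \<noteq> {}"
    using P J by (auto intro!: finite_PiE simp: PiE_eq_empty_iff)
  show "0 \<le> real (card P) * (D / 16)" using D by simp
  fix est assume est: "est \<in> estimators I"
  note est[unfolded estimators_def, measurable]
  let ?m = "real (card J)"
  define \<theta> where "\<theta> f = (\<lambda>x\<in>I. \<Sum>b\<in>P. \<phi> b (f b) x)" for f
  define r where "r b f z = (\<Sum>x\<in>B b. (est (\<lambda>w\<in>I. \<theta> f w + \<sigma> * z w) x - \<theta> f x)\<^sup>2)" for b f z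
  have est_meas[measurable]: "(\<lambda>z. est (\<lambda>w\<in>I. \<theta> f w + \<sigma> * z w) x) \<in> borel_measurable (\<Pi>\<^sub>M x\<in>I. borel)" if "x \<in> I" for x f
    using that by measurable
  have [measurable]: "r b f \<in> borel_measurable (\<Pi>\<^sub>M x\<in>I. borel)" if "b \<in> P" for b f
    unfolding r_def using sub[OF that]
    by (intro borel_measurable_sum borel_measurable_power borel_measurable_diff est_meas) auto
  have block: "ennreal (real (card (P \<rightarrow>\<^sub>E J)) * (D / 16)) \<le>
      (\<Sum>f\<in>P \<rightarrow>\<^sub>E J. \<integral>\<^sup>+z. ennreal (r b f z) \<partial>std_gaussian I)" if b: "b \<in> P" for b
  proof -
    let ?G = "(P - {b}) \<rightarrow>\<^sub>E J"
    \<comment> \<open>A choice on \<open>P\<close> splits into the choice at \<open>b\<close> and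
      the choice on the other blocks, which is held fixed while the position in \<open>b\<close>
      varies.\<close>
    have F: "P \<rightarrow>\<^sub>E J = (\<lambda>(y, g). g(b := y)) ` (J \<times> ?G)"
      using PiE_insert_eq[of b "P - {b}" "\<lambda>_. J"] b by (simp add: insert_absorb)
    have inj: "inj_on (\<lambda>(y, g). g(b := y)) (J \<times> ?G)"
      by (rule inj_combinator[where T = "\<lambda>_. J"]) simp
    have cF: "card (P \<rightarrow>\<^sub>E J) = card ?G * card J"
      unfolding F by (simp add: card_image[OF inj] card_cartesian_product)
    have "ennreal (?m * (D / 16)) \<le> (\<Sum>j\<in>J. \<integral>\<^sup>+z. ennreal (r b (g(b := j)) z) \<partial>std_gaussian I)"
      if g: "g \<in> ?G" for g
    proof (unfold r_def, rule separated_hypotheses_risk[where ?\<theta>0.0 = "\<lambda>x. \<Sum>a\<in>P - {b}. \<phi> a (g a) x"])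
      have eq: "\<theta> (g(b := j)) x = \<phi> b j x + (\<Sum>a\<in>P - {b}. \<phi> a (g a) x)" if "x \<in> I" for j x
      proof -
        have "(\<Sum>a\<in>P - {b}. \<phi> a ((g(b := j)) a) x) = (\<Sum>a\<in>P - {b}. \<phi> a (g a) x)"
          by (intro sum.cong) auto
        then show ?thesis
          using that sum.remove[OF P b, of "\<lambda>a. \<phi> a ((g(b := j)) a) x"] by (simp add: \<theta>_def)
      qed
      show "(\<Sum>x\<in>I. (\<theta> (g(b := j)) x - (\<Sum>a\<in>P - {b}. \<phi> a (g a) x))\<^sup>2) \<le> \<sigma>\<^sup>2 * ln (?m / 8)"
        if "j \<in> J" for j
        using near[OF b that] by (simp add: eq cong: sum.cong)
      show "D \<le> (\<Sum>x\<in>B b. (\<theta> (g(b := i)) x - \<theta> (g(b := j)) x)\<^sup>2)" if "i \<in> J" "j \<in> J" "i \<noteq> j" for i j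
      proof -
        \<comment> \<open>The contributions of the other blocks cancel in the difference, whatever
          their values on \<open>B b\<close>.\<close>
        have "(\<Sum>x\<in>B b. (\<theta> (g(b := i)) x - \<theta> (g(b := j)) x)\<^sup>2) = (\<Sum>x\<in>B b. (\<phi> b i x - \<phi> b j x)\<^sup>2)"
          using sub[OF b] by (intro sum.cong refl) (simp add: eq subset_iff)
        then show ?thesis using sep[OF b that] by simp
      qed
    qed (use fin sub[OF b] J \<sigma> D est in auto)
    then have "(\<Sum>g\<in>?G. ennreal (?m * (D / 16))) \<le>
        (\<Sum>g\<in>?G. \<Sum>j\<in>J. \<integral>\<^sup>+z. ennreal (r b (g(b := j)) z) \<partial>std_gaussian I)"
      by (intro sum_mono)
    also have "(\<Sum>g\<in>?G. ennreal (?m * (D / 16))) = ennreal (real (card (P \<rightarrow>\<^sub>E J)) * (D / 16))"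
      using D by (subst sum_ennreal) (auto simp: cF)
    also have "(\<Sum>g\<in>?G. \<Sum>j\<in>J. \<integral>\<^sup>+z. ennreal (r b (g(b := j)) z) \<partial>std_gaussian I) =
        (\<Sum>f\<in>P \<rightarrow>\<^sub>E J. \<integral>\<^sup>+z. ennreal (r b f z) \<partial>std_gaussian I)"
      unfolding F sum.reindex[OF inj]
      by (subst sum.swap) (simp add: sum.cartesian_product case_prod_unfold)
    finally show ?thesis .
  qed
  have risk: "(\<Sum>b\<in>P. \<integral>\<^sup>+z. ennreal (r b f z) \<partial>std_gaussian I) \<le> sq_risk I \<sigma> est (\<theta> f)" for f
  proof -
    have "(\<Sum>b\<in>P. ennreal (r b f z)) \<le> ennreal ((L2_set (\<lambda>x. est (\<lambda>w\<in>I. \<theta> f w + \<sigma> * z w) x - \<theta> f x) I)\<^sup>2)" for z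
    proof -
      have finB: "finite (B b)" if "b \<in> P" for b using sub[OF that] fin finite_subset by blast
      have "(\<Sum>b\<in>P. r b f z) = (\<Sum>x\<in>(\<Union>b\<in>P. B b). (est (\<lambda>w\<in>I. \<theta> f w + \<sigma> * z w) x - \<theta> f x)\<^sup>2)"
        unfolding r_def using disj finB
        by (subst sum.UNION_disjoint) (auto simp: P disjoint_family_on_def)
      also have "\<dots> \<le> (\<Sum>x\<in>I. (est (\<lambda>w\<in>I. \<theta> f w + \<sigma> * z w) x - \<theta> f x)\<^sup>2)"
        using sub fin by (intro sum_mono2) auto
      finally show ?thesis
        by (simp add: sum_ennreal r_def sum_nonneg L2_set_def ennreal_leI)
    qed
    then show ?thesis
      unfolding sq_risk_def by (subst nn_integral_sum[symmetric]) (auto intro!: nn_integral_mono)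
  qed
  have "ennreal (real (card (P \<rightarrow>\<^sub>E J)) * (real (card P) * (D / 16))) =
      (\<Sum>b\<in>P. ennreal (real (card (P \<rightarrow>\<^sub>E J)) * (D / 16)))"
    using D by (subst sum_ennreal) auto
  also have "\<dots> \<le> (\<Sum>b\<in>P. \<Sum>f\<in>P \<rightarrow>\<^sub>E J. \<integral>\<^sup>+z. ennreal (r b f z) \<partial>std_gaussian I)"
    by (intro sum_mono block)
  also have "\<dots> \<le> (\<Sum>f\<in>P \<rightarrow>\<^sub>E J. sq_risk I \<sigma> est (\<theta> f))"
    by (subst sum.swap) (intro sum_mono risk)
  finally show "ennreal (real (card (P \<rightarrow>\<^sub>E J)) * (real (card P) * (D / 16))) \<le>
      (\<Sum>f\<in>P \<rightarrow>\<^sub>E J. sq_risk I \<sigma> est (\<lambda>x\<in>I. \<Sum>b\<in>P. \<phi> b (f b) x))"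
    by (simp add: \<theta>_def)
qed (rule K)

section \<open>Total variation of cells\<close>

text \<open>Cells are indexed from 0 while coordinates start at 1; intervals open on the left
  reconcile the two. Coordinates outside \<open>S\<close> are free, so on the lattice the indicator
  depends only on the restriction to \<open>S\<close>.\<close>

definition cell :: "nat \<Rightarrow> nat \<Rightarrow> nat set \<Rightarrow> nat \<Rightarrow> (nat \<Rightarrow> nat) \<Rightarrow> (nat \<Rightarrow> nat) set" where
  "cell d n S h p = (\<Pi>\<^sub>E i\<in>{1..d}. if i \<in> S then {p i * h<..p i * h + h} else {1..n})"

section \<open>Counting and disjointness of cells\<close>

lemma finite_lattice [simp]: "finite (lattice d n)"
  unfolding lattice_def by (intro finite_PiE) auto

lemma card_lattice: "card (lattice d n) = n ^ d"
  by (simp add: lattice_def card_PiE)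

lemma prod_if_subset:
  fixes d :: nat and a b :: "'a :: comm_monoid_mult"
  assumes "S \<subseteq> {1..d}"
  shows "(\<Prod>i\<in>{1..d}. if i \<in> S then a else b) = a ^ card S * b ^ (d - card S)"
proof -
  have "finite S" using assms finite_subset by blast
  have "{1..d} \<inter> {i. i \<in> S} = S" "{1..d} \<inter> - {i. i \<in> S} = {1..d} - S"
    using assms by auto
  then show ?thesis
    using assms \<open>finite S\<close> by (simp add: prod.If_cases card_Diff_subset)
qed

lemma card_cell:
  assumes "S \<subseteq> {1..d}"
  shows "card (cell d n S h p) = h ^ card S * n ^ (d - card S)"
proof -
  have "card (cell d n S h p) = (\<Prod>i\<in>{1..d}. if i \<in> S then h else n)"
    unfolding cell_def by (simp add: card_PiE if_distrib cong: if_cong)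
  then show ?thesis using prod_if_subset[OF assms] by simp
qed

lemma cell_subset_lattice:
  assumes "p \<in> S \<rightarrow>\<^sub>E {..<n div h}"
  shows "cell d n S h p \<subseteq> lattice d n"
  unfolding cell_def lattice_def
proof (rule PiE_mono)
  fix i assume "i \<in> {1..d}"
  have "p i * h + h \<le> n" if "i \<in> S"
  proof -
    have "Suc (p i) \<le> n div h" using assms that by (auto simp: PiE_iff)
    then have "Suc (p i) * h \<le> n div h * h" by (rule mult_le_mono1)
    also have "\<dots> \<le> n" by simp
    finally show ?thesis by simp
  qed
  then show "(if i \<in> S then {p i * h<..p i * h + h} else {1..n}) \<subseteq> {1..n}" by auto
qed

lemma cell_disjoint:
  assumes S: "S \<subseteq> {1..d}" and p: "p \<in> S \<rightarrow>\<^sub>E Q" and p': "p' \<in> S \<rightarrow>\<^sub>E Q" and "p \<noteq> p'"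
  shows "cell d n S h p \<inter> cell d n S h p' = {}"
proof (rule ccontr)
  assume "cell d n S h p \<inter> cell d n S h p' \<noteq> {}"
  then obtain x where x: "x \<in> cell d n S h p" "x \<in> cell d n S h p'" by blast
  have "p i = p' i" if "i \<in> S" for i
  proof -
    have *: "p i * h < x i" "x i \<le> p i * h + h" "p' i * h < x i" "x i \<le> p' i * h + h"
      using PiE_mem[OF x(1)[unfolded cell_def], of i] PiE_mem[OF x(2)[unfolded cell_def], of i] that S
      by auto
    \<comment> \<open>Both intervals contain \<open>x i\<close>, so each begins before the other
      ends; for intervals of length \<open>h\<close> starting at multiples of \<open>h\<close> this
      forces equal indices.\<close>
    then have "p i * h < Suc (p' i) * h" "p' i * h < Suc (p i) * h" by auto
    then have "p i < Suc (p' i)" "p' i < Suc (p i)" by (metis mult_less_cancel2)+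
    then show ?thesis by simp
  qed
  then have "p = p'" using p p' by (intro PiE_ext) auto
  with \<open>p \<noteq> p'\<close> show False by blast
qed

text \<open>Membership tests only the coordinates in \<open>S\<close>, the others being in range
  anyway. Hence bumps on cells have the invariance demanded by \<open>TV_ball_on\<close>, and no
  edge in a direction outside \<open>S\<close> crosses the boundary of a cell.\<close>

lemma cell_restrict_cong:
  assumes "S \<subseteq> {1..d}" "x \<in> lattice d n" "x' \<in> lattice d n" "restrict x S = restrict x' S"
  shows "x \<in> cell d n S h p \<longleftrightarrow> x' \<in> cell d n S h p"
proof -
  have "x i = x' i" if "i \<in> S" for i
    using fun_cong[OF assms(4), of i] that by simp
  then show ?thesis
    using assms(2,3) by (auto simp: cell_def lattice_def PiE_iff split: if_splits)
qed

section \<open>Edges and the total variation of an indicator\<close>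

lemma finite_lattice_edges [simp]: "finite (lattice_edges d n)"
  by (rule finite_subset[of _ "lattice d n \<times> lattice d n"]) (auto simp: lattice_edges_def)

text \<open>A sum of absolute values of integers that equals 1 has a single nonzero term, and the
  orientation in \<open>lattice_edges\<close> gives its sign.\<close>

lemma lattice_edgesE:
  assumes "(u, v) \<in> lattice_edges d n"
  obtains i where "i \<in> {1..d}" "u \<in> lattice d n" "v \<in> lattice d n" "v = u(i := Suc (u i))"
proof -
  have uv: "u \<in> lattice d n" "v \<in> lattice d n" "\<forall>i\<in>{1..d}. u i \<le> v i"
    and d1: "(\<Sum>i\<in>{1..d}. \<bar>int (u i) - int (v i)\<bar>) = 1"
    using assms by (auto simp: lattice_edges_def l1_dist_def)
  obtain i where i: "i \<in> {1..d}" "\<bar>int (u i) - int (v i)\<bar> \<noteq> 0"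
    using d1 by (metis (no_types, lifting) sum.neutral zero_neq_one)
  have "\<bar>int (u i) - int (v i)\<bar> + (\<Sum>j\<in>{1..d} - {i}. \<bar>int (u j) - int (v j)\<bar>) = 1"
    using d1 sum.remove[of "{1..d}" i "\<lambda>i. \<bar>int (u i) - int (v i)\<bar>"] i by simp
  moreover have nn: "(\<Sum>j\<in>{1..d} - {i}. \<bar>int (u j) - int (v j)\<bar>) \<ge> 0"
    by (intro sum_nonneg) simp
  ultimately have *: "\<bar>int (u i) - int (v i)\<bar> = 1" "(\<Sum>j\<in>{1..d} - {i}. \<bar>int (u j) - int (v j)\<bar>) = 0"
    using i(2) by linarith+
  have "u i \<le> v i" using uv(3) i(1) by blast
  then have "v i = Suc (u i)" using *(1) by linarith
  moreover have "v j = u j" if "j \<in> {1..d} - {i}" for j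
    using *(2) that by (subst (asm) sum_nonneg_eq_0_iff) auto
  \<comment> \<open>Off \<open>{1..d}\<close> both points are \<open>undefined\<close>, which turns
    agreement of coordinates into equality of functions.\<close>
  moreover have "v j = u j" if "j \<notin> {1..d}" for j
    using uv(1,2) PiE_arb[of _ "{1..d}" "\<lambda>_. {1..n}" j] that unfolding lattice_def by metis
  ultimately have "v = u(i := Suc (u i))"
    by (intro ext) (metis DiffI fun_upd_apply singletonD)
  with i(1) uv show thesis by (intro that)
qed

lemma TV_cong:
  assumes "\<And>x. x \<in> lattice d n \<Longrightarrow> \<theta> x = \<theta>' x"
  shows "TV d n \<theta> = TV d n \<theta>'"
  unfolding TV_def using assms by (intro sum.cong) (auto simp: lattice_edges_def)

lemma TV_sum_le: "TV d n (\<lambda>x. \<Sum>b\<in>P. \<phi> b x) \<le> (\<Sum>b\<in>P. TV d n (\<phi> b))"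
proof -
  have "TV d n (\<lambda>x. \<Sum>b\<in>P. \<phi> b x) \<le> (\<Sum>(u, v)\<in>lattice_edges d n. \<Sum>b\<in>P. \<bar>\<phi> b u - \<phi> b v\<bar>)"
    unfolding TV_def by (intro sum_mono) (auto simp: sum_subtractf[symmetric])
  also have "\<dots> = (\<Sum>b\<in>P. TV d n (\<phi> b))"
    unfolding TV_def case_prod_unfold by (rule sum.swap)
  finally show ?thesis .
qed

text \<open>An edge across the boundary runs in a direction \<open>i\<close> of \<open>S\<close> and
  passes one of the two faces orthogonal to \<open>i\<close>. Its remaining coordinates lie in the
  cell, which leaves at most \<open>2 * h ^ (card S - 1) * n ^ (d - card S)\<close> edges per
  direction.\<close>

lemma TV_cell_le:
  assumes S: "S \<subseteq> {1..d}" and h: "h \<ge> 1"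
  shows "TV d n (\<lambda>x. a * indicator (cell d n S h p) x) \<le>
    \<bar>a\<bar> * (2 * real (card S) * real h ^ (card S - 1) * real n ^ (d - card S))"
proof -
  let ?C = "cell d n S h p"
  let ?s = "card S"
  have finS: "finite S" using S finite_subset by blast
  define T where "T = {(u, v) \<in> lattice_edges d n. (u \<in> ?C) \<noteq> (v \<in> ?C)}"
  \<comment> \<open>Possible lower endpoints in direction \<open>i\<close>: the layer just before
    the cell and the last layer inside it. For \<open>p i = 0\<close> the former is outside the
    lattice, which is harmless for an upper bound.\<close>
  define R where "R i = (\<Pi>\<^sub>E j\<in>{1..d}. if j = i then {p i * h, p i * h + h}
     else if j \<in> S then {p j * h<..p j * h + h} else {1..n})" for i
  have finR: "finite (R i)" for i unfolding R_def by (intro finite_PiE) auto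
  have cardR: "card (R i) = 2 * h ^ (?s - 1) * n ^ (d - ?s)" if i: "i \<in> S" for i
  proof -
    have i': "i \<in> {1..d}" using i S by auto
    \<comment> \<open>The two layers are distinct because \<open>h \<ge> 1\<close>.\<close>
    have "card (R i) = (\<Prod>j\<in>{1..d}. if j = i then 2 else if j \<in> S then h else n)"
      unfolding R_def using h by (subst card_PiE) (auto intro!: prod.cong)
    also have "\<dots> = 2 * (\<Prod>j\<in>{1..d} - {i}. if j \<in> S then h else n)"
      using i' by (subst prod.remove[of _ i]) (auto intro!: prod.cong)
    also have "(\<Prod>j\<in>{1..d} - {i}. if j \<in> S then h else n) = h ^ (?s - 1) * n ^ (d - ?s)"
    proof -
      have "({1..d} - {i}) \<inter> {j. j \<in> S} = S - {i}" "({1..d} - {i}) \<inter> - {j. j \<in> S} = {1..d} - S"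
        using S i by auto
      then show ?thesis
        using S finS i by (simp add: prod.If_cases card_Diff_subset)
    qed
    finally show ?thesis by simp
  qed
  have "T \<subseteq> (\<lambda>(i, u). (u, u(i := Suc (u i)))) ` (SIGMA i:S. R i)"
  proof
    fix e assume "e \<in> T"
    then obtain u v where e: "e = (u, v)" and uv: "(u, v) \<in> lattice_edges d n" "(u \<in> ?C) \<noteq> (v \<in> ?C)"
      by (auto simp: T_def)
    from uv(1) obtain i where i: "i \<in> {1..d}" "u \<in> lattice d n" "v \<in> lattice d n" "v = u(i := Suc (u i))"
      by (rule lattice_edgesE)
    have iS: "i \<in> S"
    proof (rule ccontr)
      assume "i \<notin> S"
      then have "restrict u S = restrict v S" using i(4) by (auto simp: restrict_def)
      then show False using cell_restrict_cong[OF S i(2,3)] uv(2) by blast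
    qed
    have ext: "u \<in> extensional {1..d}" "v \<in> extensional {1..d}"
      using i(2,3) by (auto simp: lattice_def PiE_iff)
    have uC: "u \<in> ?C \<longleftrightarrow> (\<forall>j\<in>{1..d}. u j \<in> (if j \<in> S then {p j * h<..p j * h + h} else {1..n}))"
      using ext by (simp add: cell_def PiE_iff)
    have vC: "v \<in> ?C \<longleftrightarrow> (\<forall>j\<in>{1..d}. v j \<in> (if j \<in> S then {p j * h<..p j * h + h} else {1..n}))"
      using ext by (simp add: cell_def PiE_iff)
    \<comment> \<open>One endpoint lies in the cell and the endpoints agree away from
      \<open>i\<close>, so \<open>u\<close> has the right coordinates there whichever endpoint it
      is.\<close>
    have rest: "u j \<in> (if j \<in> S then {p j * h<..p j * h + h} else {1..n})" if "j \<in> {1..d}" "j \<noteq> i" for j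
    proof (cases "u \<in> ?C")
      case True
      then show ?thesis using uC that by blast
    next
      case False
      then have "v \<in> ?C" using uv(2) by blast
      then have "v j \<in> (if j \<in> S then {p j * h<..p j * h + h} else {1..n})" using vC that by blast
      moreover have "v j = u j" using i(4) that by simp
      ultimately show ?thesis by simp
    qed
    have "u \<in> ?C \<longleftrightarrow> u i \<in> (if i \<in> S then {p i * h<..p i * h + h} else {1..n})"
      using uC rest i(1) by blast
    then have "u \<in> ?C \<longleftrightarrow> u i \<in> {p i * h<..p i * h + h}" using iS by simp
    moreover have "v \<in> ?C \<longleftrightarrow> Suc (u i) \<in> {p i * h<..p i * h + h}"
    proof -
      have "v j \<in> (if j \<in> S then {p j * h<..p j * h + h} else {1..n})" if "j \<in> {1..d}" "j \<noteq> i" for j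
        using rest[OF that] i(4) that(2) by simp
      then have "v \<in> ?C \<longleftrightarrow> v i \<in> (if i \<in> S then {p i * h<..p i * h + h} else {1..n})"
        using vC i(1) by blast
      then show ?thesis using i(4) iS by simp
    qed
    ultimately have "u i = p i * h \<or> u i = p i * h + h" using uv(2) by auto
    then have "u \<in> R i" unfolding R_def using rest ext(1) by (auto simp: PiE_iff)
    then show "e \<in> (\<lambda>(i, u). (u, u(i := Suc (u i)))) ` (SIGMA i:S. R i)"
      using iS i(4) e by force
  qed
  then have "card T \<le> card ((\<lambda>(i, u). (u, u(i := Suc (u i)))) ` (SIGMA i:S. R i))"
    using finS finR by (intro card_mono finite_imageI finite_SigmaI) auto
  also have "\<dots> \<le> card (SIGMA i:S. R i)"
    using finS finR by (intro card_image_le finite_SigmaI) auto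
  also have "\<dots> = 2 * ?s * h ^ (?s - 1) * n ^ (d - ?s)"
    using finS finR by (subst card_SigmaI) (auto simp: cardR)
  finally have "real (card T) \<le> real (2 * ?s * h ^ (?s - 1) * n ^ (d - ?s))"
    by (simp only: of_nat_le_iff)
  then have T: "real (card T) \<le> 2 * real ?s * real h ^ (?s - 1) * real n ^ (d - ?s)"
    by simp
  have "TV d n (\<lambda>x. a * indicator ?C x) = (\<Sum>e\<in>lattice_edges d n. if e \<in> T then \<bar>a\<bar> else 0)"
    unfolding TV_def by (intro sum.cong refl) (auto simp: T_def indicator_def)
  also have "\<dots> = (\<Sum>e\<in>T. \<bar>a\<bar>)"
  proof -
    have "lattice_edges d n \<inter> T = T" by (auto simp: T_def)
    then show ?thesis by (simp add: sum.If_cases)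
  qed
  also have "\<dots> = \<bar>a\<bar> * real (card T)" by simp
  also have "\<dots> \<le> \<bar>a\<bar> * (2 * real ?s * real h ^ (?s - 1) * real n ^ (d - ?s))"
    using T by (intro mult_left_mono) auto
  finally show ?thesis .
qed

text \<open>Two bumps in different cells of a block differ on both cells, so their squared distance
  is twice the squared norm of a bump; with the factor 1/16 of the product prior this gives 1/8. The
  condition \<open>tv\<close> sums the cost of one bump per block.\<close>

lemma minimax_risk_ge_cells:
  assumes n: "n \<ge> 1" and S: "S \<subseteq> {1..d}" and h: "h \<ge> 1" and m: "m \<ge> 1" and \<sigma>: "\<sigma> > 0" and a: "a \<ge> 0"
    and km: "k * m \<le> (n div h) ^ card S"
    and near: "a\<^sup>2 * (real h ^ card S * real n ^ (d - card S)) \<le> \<sigma>\<^sup>2 * ln (real m / 8)"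
    and tv: "real k * (a * (2 * real (card S) * real h ^ (card S - 1) * real n ^ (d - card S))) \<le> V"
  shows "ennreal (real k * (a\<^sup>2 * (real h ^ card S * real n ^ (d - card S))) / 8) \<le>
    minimax_risk (lattice d n) \<sigma> (TV_ball_on d n S V)"
proof -
  let ?Q = "S \<rightarrow>\<^sub>E {..<n div h}"
  let ?I = "lattice d n"
  define c where "c = real h ^ card S * real n ^ (d - card S)"
  have finS: "finite S" using S finite_subset by blast
  have "card ({..<k} \<times> {..<m}) \<le> card ?Q"
    using km finS by (simp add: card_PiE card_cartesian_product)
  moreover have "finite ?Q" using finS by (intro finite_PiE) auto
  \<comment> \<open>Any injection will do: neither the norm of a bump nor the bound on its total
    variation depends on where its cell lies, so blocks need not be contiguous.\<close>
  ultimately obtain e where e: "e ` ({..<k} \<times> {..<m}) \<subseteq> ?Q" "inj_on e ({..<k} \<times> {..<m})"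
    using card_le_inj[of "{..<k} \<times> {..<m}" ?Q] by auto
  define C where "C b j = cell d n S h (e (b, j))" for b j
  have CI: "C b j \<subseteq> ?I" if "b < k" "j < m" for b j
    unfolding C_def using e(1) that by (intro cell_subset_lattice) auto
  have finC: "finite (C b j)" if "b < k" "j < m" for b j
    using CI[OF that] finite_lattice finite_subset by blast
  have Cdisj: "C b j \<inter> C b' j' = {}" if "b < k" "j < m" "b' < k" "j' < m" "(b, j) \<noteq> (b', j')" for b j b' j'
  proof -
    have "e (b, j) \<noteq> e (b', j')" using e(2) that by (auto simp: inj_on_def)
    then show ?thesis unfolding C_def using e(1) that by (intro cell_disjoint[OF S]) auto
  qed
  have Ccard: "real (card (C b j)) = c" for b j
    by (simp add: C_def card_cell[OF S] c_def)
  have "ennreal (real (card {..<k}) * ((2 * a\<^sup>2 * c) / 16)) \<le> minimax_risk ?I \<sigma> (TV_ball_on d n S V)"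
  proof (rule minimax_risk_ge_product_prior[where J = "{..<m}" and B = "\<lambda>b. \<Union>j<m. C b j"
        and \<phi> = "\<lambda>b j x. a * indicator (C b j) x"])
    show "0 \<le> 2 * a\<^sup>2 * c" by (simp add: c_def)
    show "{..<m} \<noteq> {}" using m by (simp add: lessThan_empty_iff)
    show "disjoint_family_on (\<lambda>b. \<Union>j<m. C b j) {..<k}"
    proof (unfold disjoint_family_on_def, intro ballI impI)
      fix b b' assume "b \<in> {..<k}" "b' \<in> {..<k}" "b \<noteq> b'"
      then have "C b j \<inter> C b' j' = {}" if "j < m" "j' < m" for j j'
        using Cdisj that by auto
      then show "(\<Union>j<m. C b j) \<inter> (\<Union>j<m. C b' j) = {}" by blast
    qed
    show "(\<Sum>x\<in>?I. (a * indicator (C b j) x)\<^sup>2) \<le> \<sigma>\<^sup>2 * ln (real (card {..<m}) / 8)"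
      if "b \<in> {..<k}" "j \<in> {..<m}" for b j
    proof -
      have "?I \<inter> C b j = C b j" using CI that by auto
      have "(\<Sum>x\<in>?I. (a * indicator (C b j) x)\<^sup>2) = (\<Sum>x\<in>?I. if x \<in> C b j then a\<^sup>2 else 0)"
        by (intro sum.cong) (auto simp: indicator_def)
      also have "\<dots> = a\<^sup>2 * c"
        using \<open>?I \<inter> C b j = C b j\<close> by (simp add: sum.If_cases Ccard)
      finally show ?thesis using near by (simp add: c_def)
    qed
    show "2 * a\<^sup>2 * c \<le> (\<Sum>x\<in>(\<Union>j<m. C b j). (a * indicator (C b i) x - a * indicator (C b j) x)\<^sup>2)"
      if "b \<in> {..<k}" "i \<in> {..<m}" "j \<in> {..<m}" "i \<noteq> j" for b i j
    proof -
      have dj: "C b i \<inter> C b j = {}" using Cdisj that by auto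
      have "2 * a\<^sup>2 * c = (\<Sum>x\<in>C b i \<union> C b j. a\<^sup>2)"
        using dj finC that by (simp add: card_Un_disjoint Ccard)
      also have "\<dots> = (\<Sum>x\<in>C b i \<union> C b j. (a * indicator (C b i) x - a * indicator (C b j) x)\<^sup>2)"
        using dj by (intro sum.cong) (auto simp: indicator_def)
      also have "\<dots> \<le> (\<Sum>x\<in>(\<Union>j<m. C b j). (a * indicator (C b i) x - a * indicator (C b j) x)\<^sup>2)"
        using that finC by (intro sum_mono2) auto
      finally show ?thesis .
    qed
    show "(\<lambda>x\<in>?I. \<Sum>b<k. a * indicator (C b (f b)) x) \<in> TV_ball_on d n S V"
      if f: "f \<in> {..<k} \<rightarrow>\<^sub>E {..<m}" for f
    proof -
      have "TV d n (\<lambda>x\<in>?I. \<Sum>b<k. a * indicator (C b (f b)) x) = TV d n (\<lambda>x. \<Sum>b<k. a * indicator (C b (f b)) x)"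
        by (intro TV_cong) simp
      also have "\<dots> \<le> (\<Sum>b<k. TV d n (\<lambda>x. a * indicator (C b (f b)) x))"
        by (rule TV_sum_le)
      also have "\<dots> \<le> (\<Sum>b<k. \<bar>a\<bar> * (2 * real (card S) * real h ^ (card S - 1) * real n ^ (d - card S)))"
        unfolding C_def by (intro sum_mono TV_cell_le S h)
      also have "\<dots> \<le> V" using tv a by simp
      finally have "TV d n (\<lambda>x\<in>?I. \<Sum>b<k. a * indicator (C b (f b)) x) \<le> V" .
      moreover have "(\<Sum>b<k. a * indicator (C b (f b)) x) = (\<Sum>b<k. a * indicator (C b (f b)) x')"
        if "x \<in> ?I" "x' \<in> ?I" "restrict x S = restrict x' S" for x x'
        using cell_restrict_cong[OF S that] by (simp add: C_def indicator_def)
      ultimately show ?thesis by (simp add: TV_ball_on_def TV_ball_def)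
    qed
    show "(\<Union>j<m. C b j) \<subseteq> ?I" if "b \<in> {..<k}" for b using CI that by auto
  qed (use \<sigma> in auto)
  then show ?thesis by (simp add: c_def mult.assoc)
qed

text \<open>Constant signals have zero total variation. Sixteen of them with spacing
  \<open>t\<close> form a single block: their squared norms stay below
  \<open>16\<^sup>2 / 1024 = 1/4\<close> in units of \<open>\<sigma>\<^sup>2\<close>, under the
  allowed \<open>ln (16 / 8)\<close>, and the separation \<open>\<sigma>\<^sup>2 / 1024\<close> is
  divided by 16.\<close>

lemma minimax_risk_ge_constants:
  assumes n: "n \<ge> 1" and \<sigma>: "\<sigma> > 0" and V: "V \<ge> 0"
  shows "ennreal (\<sigma>\<^sup>2 / 16384) \<le> minimax_risk (lattice d n) \<sigma> (TV_ball_on d n S V)"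
proof -
  let ?I = "lattice d n"
  define t where "t = \<sigma> / (32 * sqrt (real n ^ d))"
  have t: "real n ^ d * t\<^sup>2 = \<sigma>\<^sup>2 / 1024"
    using n by (simp add: t_def power_divide power_mult_distrib)
  have "ennreal (real (card {0::nat}) * ((\<sigma>\<^sup>2 / 1024) / 16)) \<le> minimax_risk ?I \<sigma> (TV_ball_on d n S V)"
  proof (rule minimax_risk_ge_product_prior[where J = "{..<16::nat}" and B = "\<lambda>_. ?I"
        and \<phi> = "\<lambda>_ j _. real j * t"])
    show "(\<Sum>x\<in>?I. (real j * t)\<^sup>2) \<le> \<sigma>\<^sup>2 * ln (real (card {..<16::nat}) / 8)" if "j \<in> {..<16}" for j
    proof -
      have "(\<Sum>x\<in>?I. (real j * t)\<^sup>2) = (real j)\<^sup>2 * (\<sigma>\<^sup>2 / 1024)"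
        by (simp add: card_lattice power_mult_distrib t[symmetric])
      also have "\<dots> \<le> 16\<^sup>2 * (\<sigma>\<^sup>2 / 1024)"
        using that by (intro mult_right_mono power_mono) auto
      also have "\<dots> \<le> \<sigma>\<^sup>2 * ln 2"
        using \<sigma> ln2_ge_two_thirds by simp
      finally show ?thesis by simp
    qed
    show "\<sigma>\<^sup>2 / 1024 \<le> (\<Sum>x\<in>?I. (real i * t - real j * t)\<^sup>2)" if "i \<noteq> j" for i j :: nat
    proof -
      have "1 \<le> \<bar>real i - real j\<bar>" using that by linarith
      then have "1 \<le> (real i - real j)\<^sup>2" by (metis one_le_power power2_abs)
      then have "\<sigma>\<^sup>2 / 1024 \<le> (real i - real j)\<^sup>2 * (\<sigma>\<^sup>2 / 1024)"
        by (simp add: mult_le_cancel_right1)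
      also have "\<dots> = (\<Sum>x\<in>?I. (real i * t - real j * t)\<^sup>2)"
        by (simp add: card_lattice power_mult_distrib t[symmetric] left_diff_distrib[symmetric])
      finally show ?thesis .
    qed
    show "(\<lambda>x\<in>?I. \<Sum>b\<in>{0::nat}. real (f b) * t) \<in> TV_ball_on d n S V" for f
    proof -
      have "TV d n (\<lambda>x\<in>?I. real (f 0) * t) = TV d n (\<lambda>x. real (f 0) * t)"
        by (intro TV_cong) simp
      also have "\<dots> = 0" by (simp add: TV_def)
      finally show ?thesis using V by (simp add: TV_ball_on_def TV_ball_def)
    qed
  qed (use \<sigma> in \<open>auto simp: disjoint_family_on_def lessThan_empty_iff\<close>)
  then show ?thesis by simp
qed

section \<open>Choice of the parameters\<close>

lemma of_nat_divide_less_div_add_1: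
  assumes "k > 0"
  shows "real N / real k < real (N div k) + 1"
proof -
  have "N < k * (N div k + 1)" using dividend_less_times_div[OF assms, of N] by simp
  then have "real N < real (k * (N div k + 1))" by (simp only: of_nat_less_iff)
  then show ?thesis using assms by (simp add: field_simps)
qed

text \<open>\<open>N\<close> is the dimension and \<open>\<rho>\<close> the radius of the \<open>\<ell>\<^sub>1\<close>-ball in units of the noise level. The three cases
  of the proof are the dense regime (\<open>N \<le> 1024 \<rho>\<close>), many spikes at the detection threshold \<open>\<alpha>\<close>, and a
  single spike of height \<open>\<rho> < \<alpha>\<close>.\<close>

lemma sparse_configuration:
  fixes N :: nat and \<rho> M :: real
  assumes \<rho>: "\<rho> > 0" and M1: "M \<le> \<rho> * sqrt (1 + ln (real N / \<rho>))" and M2: "M \<le> real N"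
    and M3: "M \<le> 4 * \<rho>\<^sup>2 + 1" and M: "M > 16"
  obtains k m :: nat and \<alpha> :: real where "m \<ge> 1" "\<alpha> \<ge> 0" "k * m \<le> N" "\<alpha>\<^sup>2 \<le> ln (real m / 8)"
    "real k * \<alpha> \<le> \<rho>" "M \<le> 131072 * (real k * \<alpha>\<^sup>2)"
proof -
  \<comment> \<open>For \<open>\<rho> \<le> 1\<close> the bound \<open>M3\<close> would give
    \<open>M \<le> 5\<close>.\<close>
  have \<rho>1: "\<rho> > 1"
  proof (rule ccontr)
    assume "\<not> \<rho> > 1"
    then have "\<rho>\<^sup>2 \<le> 1" using \<rho> by (simp add: power_le_one)
    with M3 M show False by simp
  qed
  show thesis
  proof (cases "real N \<le> 1024 * \<rho>")
    case True
    define k where "k = N div 16"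
    have k1: "16 * k \<le> N" unfolding k_def by simp
    have "N < 16 * k + 16" unfolding k_def by simp
    moreover have "N \<ge> 16" using M2 M by simp
    then have "k \<ge> 1" unfolding k_def by simp
    ultimately have k2: "N \<le> 32 * k" by simp
    show thesis
    \<comment> \<open>Height 1/64 keeps \<open>k / 64 \<le> N / 1024\<close> within the budget
      \<open>\<rho>\<close>. Since \<open>M \<le> N \<le> 32 * k\<close>, the constant 131072 is
      \<open>32 * 64\<^sup>2\<close>.\<close>
    proof (rule that[of 16 "1 / 64" k])
      show "(1 / 64)\<^sup>2 \<le> ln (real 16 / 8)"
        using ln2_ge_two_thirds by (simp add: power2_eq_square)
      show "real k * (1 / 64) \<le> \<rho>" using k1 True by linarith
      show "M \<le> 131072 * (real k * (1 / 64)\<^sup>2)" using k2 M2 by (simp add: power2_eq_square)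
    qed (use k1 in auto)
  next
    case False
    define x where "x = real N / \<rho>"
    have x: "x > 1024" using False \<rho> by (simp add: x_def field_simps)
    have "ln 1024 \<le> ln x" using x by simp
    moreover have "ln (1024::real) = 2 * ln 32"
      using ln_realpow[of "32::real" 2] by simp
    moreover have "ln (32::real) \<ge> 1"
      using exp_le by (subst ln_ge_iff) auto
    \<comment> \<open>As \<open>x > 32\<^sup>2\<close>, dividing \<open>x\<close> by 32 costs at
      most half of the logarithm. The factor 32 is spent below on \<open>m \<ge> x / 4\<close> and
      on the 8 in \<open>ln (m / 8)\<close>.\<close>
    ultimately have lnx: "ln x \<ge> 1" "ln x / 2 \<le> ln (x / 32)"
      using x by (auto simp: ln_div)
    \<comment> \<open>Half the root in \<open>M1\<close>, which then reads
      \<open>M \<le> 2 * \<rho> * \<alpha>\<close>; the half also brings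
      \<open>\<alpha>\<^sup>2\<close> below \<open>ln x / 2\<close>.\<close>
    define \<alpha> where "\<alpha> = sqrt (1 + ln x) / 2"
    have \<alpha>2: "\<alpha>\<^sup>2 = (1 + ln x) / 4" using lnx by (simp add: \<alpha>_def power_divide)
    then have \<alpha>3: "\<alpha>\<^sup>2 \<le> ln (x / 32)" using lnx by simp
    have \<alpha>1: "\<alpha> \<ge> 1 / 2" using lnx by (simp add: \<alpha>_def)
    show thesis
    proof (cases "\<rho> \<ge> \<alpha>")
      case True
      \<comment> \<open>The budget pays for \<open>k\<close> spikes of height
        \<open>\<alpha>\<close>; rounding down a number that is at least 1 loses at most a factor
        2.\<close>
      define k where "k = nat \<lfloor>\<rho> / \<alpha>\<rfloor>"
      have r1: "\<rho> / \<alpha> \<ge> 1" using True \<alpha>1 by (simp add: field_simps)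
      have k1: "real k \<le> \<rho> / \<alpha>" using r1 by (simp add: k_def)
      have k2: "k \<ge> 1" using r1 by (simp add: k_def le_nat_iff le_floor_iff)
      have "\<rho> / \<alpha> < real k + 1" using r1 unfolding k_def by linarith
      with k2 have k3: "\<rho> / \<alpha> \<le> 2 * real k" by linarith
      have ka: "real k * \<alpha> \<le> \<rho>" using k1 \<alpha>1 by (simp add: field_simps)
      define m where "m = N div k"
      \<comment> \<open>Since \<open>\<alpha> \<ge> 1 / 2\<close>, there are at most
        \<open>2 * \<rho>\<close> blocks to share the \<open>N\<close> points.\<close>
      have "x / 2 \<le> real N / real k"
      proof -
        have "x / 2 * real k \<le> x * \<alpha> * real k"
          using x \<alpha>1 by (intro mult_right_mono) auto
        also have "\<dots> = x * (real k * \<alpha>)" by simp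
        also have "\<dots> \<le> x * \<rho>" using ka x by (intro mult_left_mono) auto
        also have "\<dots> = real N" using \<rho> by (simp add: x_def)
        finally show ?thesis using k2 by (simp add: field_simps)
      qed
      moreover have "real N / real k < real m + 1"
        unfolding m_def using k2 by (intro of_nat_divide_less_div_add_1) simp
      ultimately have m: "real m \<ge> x / 4" using x by linarith
      have km: "k * m \<le> N" unfolding m_def by simp
      show thesis
      proof (rule that[of m \<alpha> k])
        have "x / 32 \<le> real m / 8" using m by simp
        then have "ln (x / 32) \<le> ln (real m / 8)" using x by (subst ln_le_cancel_iff) auto
        then show "\<alpha>\<^sup>2 \<le> ln (real m / 8)" using \<alpha>3 by simp
        have "M \<le> 2 * \<rho> * \<alpha>" using M1 by (simp add: \<alpha>_def x_def)
        also have "\<dots> \<le> 2 * (2 * real k * \<alpha>) * \<alpha>"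
          using k3 \<alpha>1 by (intro mult_right_mono mult_left_mono) (auto simp: field_simps)
        also have "\<dots> = 4 * (real k * \<alpha>\<^sup>2)" by (simp add: power2_eq_square)
        also have "\<dots> \<le> 131072 * (real k * \<alpha>\<^sup>2)" by (intro mult_right_mono) auto
        finally show "M \<le> 131072 * (real k * \<alpha>\<^sup>2)" .
      qed (use m x \<alpha>1 km ka in auto)
    next
      case False
      show thesis
      \<comment> \<open>One block of all \<open>N\<close> points. From \<open>\<rho> > 1\<close>
        follow \<open>x \<le> N\<close>, so that the height \<open>\<rho> < \<alpha>\<close> is
        admissible, and \<open>4 * \<rho>\<^sup>2 + 1 \<le> 5 * \<rho>\<^sup>2\<close>.\<close>
      proof (rule that[of N \<rho> 1])
        have "x \<le> real N / 1" unfolding x_def using \<rho>1 by (intro divide_left_mono) auto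
        then have "x \<le> real N" by simp
        then have "ln (x / 32) \<le> ln (real N / 8)" using x by (subst ln_le_cancel_iff) auto
        moreover have "\<rho>\<^sup>2 \<le> \<alpha>\<^sup>2" using False \<rho> by (intro power_mono) auto
        ultimately show "\<rho>\<^sup>2 \<le> ln (real N / 8)" using \<alpha>3 by simp
        have "1 \<le> \<rho>\<^sup>2" using \<rho>1 by (simp add: one_le_power)
        then show "M \<le> 131072 * (real 1 * \<rho>\<^sup>2)" using M3 by simp
      qed (use M2 M \<rho> in auto)
    qed
  qed
qed

text \<open>Width about \<open>n / M\<close> gives about \<open>M\<close> cells, a fixed fraction of
  which is the number of blocks. Bumps of height of order \<open>1 / sqrt h\<close> in noise units
  escape detection, and the budget pays for about \<open>v * sqrt h\<close> of them. This is at
  least \<open>k\<close> because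
  \<open>M\<^sup>2 \<le> v\<^sup>2 * n / M \<le> v\<^sup>2 * h\<close>.\<close>

lemma interval_configuration:
  fixes n :: nat and v M :: real
  assumes v: "v > 0" and M1: "M \<le> real n" and M2: "M ^ 3 \<le> v\<^sup>2 * real n" and M: "M > 64"
  obtains h k :: nat where "h \<ge> 1" "k * 16 \<le> n div h" "real k \<le> v * sqrt (real h)" "M \<le> 128 * real k"
proof -
  define h where "h = nat \<lceil>real n / M\<rceil>"
  have r1: "real n / M \<ge> 1" using M1 M by (simp add: field_simps)
  have h1: "real n / M \<le> real h" unfolding h_def using r1 by linarith
  have h2: "real h \<le> 2 * (real n / M)" unfolding h_def using r1 by linarith
  have h0: "h \<ge> 1" using h1 r1 by linarith
  define q where "q = n div h"
  have q1: "real q \<le> M"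
  proof -
    have "real q \<le> real n / real h" unfolding q_def by (rule of_nat_div_le_of_nat)
    also have "\<dots> \<le> M" using h1 h0 M by (simp add: field_simps)
    finally show ?thesis .
  qed
  have "M / 2 \<le> real n / real h" using h2 h0 M by (simp add: field_simps)
  moreover have "real n / real h < real q + 1"
    unfolding q_def using h0 by (intro of_nat_divide_less_div_add_1) simp
  ultimately have q2: "real q \<ge> M / 4" using M by linarith
  \<comment> \<open>Blocks of 16 cells leave room \<open>ln (16 / 8)\<close> for the bumps. The
    constant 128 combines \<open>M \<le> 4 * q\<close> with \<open>q \<le> 32 * k\<close>.\<close>
  define k where "k = q div 16"
  have "q \<ge> 16" using q2 M by linarith
  then have "k \<ge> 1" unfolding k_def by simp
  moreover have "q < 16 * k + 16" unfolding k_def by simp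
  ultimately have k2: "q \<le> 32 * k" by simp
  have k1: "k * 16 \<le> q" unfolding k_def by simp
  show thesis
  proof (rule that[of h k])
    show "M \<le> 128 * real k" using k2 q2 by linarith
    have "(real k)\<^sup>2 \<le> M\<^sup>2" using k1 q1 by (intro power_mono) linarith+
    also have "M\<^sup>2 = M ^ 3 / M" using M by (simp add: power2_eq_square power3_eq_cube)
    also have "\<dots> \<le> v\<^sup>2 * real n / M" using M2 M by (intro divide_right_mono) auto
    also have "\<dots> \<le> v\<^sup>2 * real h" using mult_left_mono[OF h1, of "v\<^sup>2"] by simp
    also have "\<dots> = (v * sqrt (real h))\<^sup>2" by (simp add: power_mult_distrib)
    finally show "real k \<le> v * sqrt (real h)" by (rule power2_le_imp_le) (use v in auto)
  qed (use h0 k1 q_def in auto)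
qed

text \<open>A bump extends over \<open>n ^ (d - card S)\<close> copies in the directions outside
  \<open>S\<close>. Heights \<open>\<alpha> * \<sigma>\<^sub>S\<close> cancel this factor against
  the noise and leave a problem in \<open>card S\<close> dimensions with unit noise.\<close>

lemma minimax_risk_ge_scaled_cells:
  assumes n: "n \<ge> 1" and S: "S \<subseteq> {1..d}" and h: "h \<ge> 1" and m: "m \<ge> 1" and \<sigma>: "\<sigma> > 0" and \<alpha>: "\<alpha> \<ge> 0"
    and \<sigma>\<^sub>S: "\<sigma>\<^sub>S = sqrt (\<sigma>\<^sup>2 / real n ^ (d - card S))"
    and km: "k * m \<le> (n div h) ^ card S"
    and near: "\<alpha>\<^sup>2 * real h ^ card S \<le> ln (real m / 8)"
    and tv: "real k * \<alpha> * (2 * real (card S) * real h ^ (card S - 1)) * \<sigma>\<^sub>S \<le> V / real n ^ (d - card S)"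
  shows "ennreal (\<sigma>\<^sup>2 * (real k * \<alpha>\<^sup>2 * real h ^ card S) / 8) \<le>
    minimax_risk (lattice d n) \<sigma> (TV_ball_on d n S V)"
proof -
  define A where "A = real n ^ (d - card S)"
  have A: "A > 0" using n by (simp add: A_def)
  have s2: "\<sigma>\<^sub>S\<^sup>2 * A = \<sigma>\<^sup>2" using A by (simp add: \<sigma>\<^sub>S A_def[symmetric])
  have e: "(\<alpha> * \<sigma>\<^sub>S)\<^sup>2 * (real h ^ card S * A) = \<sigma>\<^sup>2 * (\<alpha>\<^sup>2 * real h ^ card S)"
    by (simp add: power_mult_distrib s2[symmetric])
  have "ennreal (real k * ((\<alpha> * \<sigma>\<^sub>S)\<^sup>2 * (real h ^ card S * real n ^ (d - card S))) / 8) \<le>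
      minimax_risk (lattice d n) \<sigma> (TV_ball_on d n S V)"
  proof (rule minimax_risk_ge_cells[OF n S h m \<sigma> _ km])
    show "0 \<le> \<alpha> * \<sigma>\<^sub>S" using \<alpha> by (simp add: \<sigma>\<^sub>S)
    show "(\<alpha> * \<sigma>\<^sub>S)\<^sup>2 * (real h ^ card S * real n ^ (d - card S)) \<le> \<sigma>\<^sup>2 * ln (real m / 8)"
      unfolding e[unfolded A_def] using near by (intro mult_left_mono) auto
    show "real k * (\<alpha> * \<sigma>\<^sub>S * (2 * real (card S) * real h ^ (card S - 1) * real n ^ (d - card S))) \<le> V"
      using tv A unfolding A_def[symmetric] by (simp add: pos_le_divide_eq mult_ac)
  qed
  then show ?thesis unfolding e[unfolded A_def] by (simp add: mult_ac)
qed

theorem theorem4p1: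
  "\<exists>c::real. c > 0 \<and>
    (\<forall>(n::nat) (d::nat) (S::nat set) (s::nat) (V::real) (\<sigma>::real) (V\<^sub>S::real) (\<sigma>\<^sub>S::real).
       n \<ge> 1 \<longrightarrow> d \<ge> 1 \<longrightarrow> S \<subseteq> {1..d} \<longrightarrow> s = card S \<longrightarrow> V > 0 \<longrightarrow> \<sigma> > 0 \<longrightarrow>
       V\<^sub>S = V / real n ^ (d - s) \<longrightarrow> \<sigma>\<^sub>S = sqrt (\<sigma>\<^sup>2 / real n ^ (d - s)) \<longrightarrow>
       (s \<ge> 2 \<longrightarrow>
          minimax_risk (lattice d n) \<sigma> (TV_ball_on d n S V) \<ge>
          ennreal (c * real n ^ (d - s) *
            Min {\<sigma>\<^sub>S * V\<^sub>S / (2 * real s) * sqrt (1 + ln (2 * \<sigma>\<^sub>S * real s * real n ^ s / V\<^sub>S)),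
                 real n ^ s * \<sigma>\<^sub>S\<^sup>2,
                 (V\<^sub>S / real s)\<^sup>2 + \<sigma>\<^sub>S\<^sup>2})) \<and>
       (s = 1 \<longrightarrow>
          minimax_risk (lattice d n) \<sigma> (TV_ball_on d n S V) \<ge>
          ennreal (c * real n ^ (d - 1) *
            Min {(\<sigma>\<^sub>S\<^sup>2 * V\<^sub>S) powr (2/3) * real n powr (1/3),
                 real n * \<sigma>\<^sub>S\<^sup>2,
                 real n * V\<^sub>S\<^sup>2})))"
proof (intro exI[of _ "1 / 1048576"] conjI allI impI)
  fix n d s :: nat and S :: "nat set" and V \<sigma> V\<^sub>S \<sigma>\<^sub>S :: real
  assume n: "n \<ge> 1" and S: "S \<subseteq> {1..d}" and s: "s = card S" and V: "V > 0" and \<sigma>: "\<sigma> > 0"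
    and V\<^sub>S: "V\<^sub>S = V / real n ^ (d - s)" and \<sigma>\<^sub>S: "\<sigma>\<^sub>S = sqrt (\<sigma>\<^sup>2 / real n ^ (d - s))"
  let ?R = "minimax_risk (lattice d n) \<sigma> (TV_ball_on d n S V)"
  define A where "A = real n ^ (d - s)"
  have A: "A > 0" using n by (simp add: A_def)
  have \<sigma>\<^sub>S0: "\<sigma>\<^sub>S > 0" using A \<sigma> by (simp add: \<sigma>\<^sub>S A_def[symmetric])
  have V\<^sub>S0: "V\<^sub>S > 0" using A V by (simp add: V\<^sub>S A_def[symmetric])
  have s2: "\<sigma>\<^sub>S\<^sup>2 * A = \<sigma>\<^sup>2" using A by (simp add: \<sigma>\<^sub>S A_def[symmetric])
  \<comment> \<open>In units of \<open>\<sigma>\<^sub>S\<^sup>2\<close> the factor \<open>A\<close>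
    disappears. The constant 1048576 is \<open>8 * 131072\<close> for the spikes and
    \<open>64 * 16384\<close> for constant signals.\<close>
  have reduce: "ennreal (1 / 1048576 * A * T) \<le> ?R"
    if "T / \<sigma>\<^sub>S\<^sup>2 \<le> 1048576 * b" "ennreal (\<sigma>\<^sup>2 * b) \<le> ?R" for T b
  proof -
    have "T \<le> 1048576 * b * \<sigma>\<^sub>S\<^sup>2" using that(1) \<sigma>\<^sub>S0 by (simp add: pos_divide_le_eq)
    then have "1 / 1048576 * A * T \<le> 1 / 1048576 * A * (1048576 * b * \<sigma>\<^sub>S\<^sup>2)"
      using A by (intro mult_left_mono) auto
    also have "\<dots> = \<sigma>\<^sup>2 * b" by (simp add: s2[symmetric])
    finally have "ennreal (1 / 1048576 * A * T) \<le> ennreal (\<sigma>\<^sup>2 * b)" by (rule ennreal_leI)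
    also note that(2)
    finally show ?thesis .
  qed
  \<comment> \<open>This includes negative \<open>T\<close>, which occurs when \<open>1 + ln\<close>
    of the ratio is negative, since \<open>sqrt\<close> of a negative real is negative.\<close>
  have small: "ennreal (1 / 1048576 * A * T) \<le> ?R" if "T / \<sigma>\<^sub>S\<^sup>2 \<le> 64" for T
    by (rule reduce[where b = "1 / 16384"])
       (use that minimax_risk_ge_constants[OF n \<sigma>, of V d S] V in auto)
  note cells = minimax_risk_ge_scaled_cells[OF n S _ _ \<sigma> _ \<sigma>\<^sub>S[unfolded s], of _ _ _ _ V, folded s, folded V\<^sub>S]
  {
    assume "s \<ge> 2"
    \<comment> \<open>At most \<open>2 * s\<close> edges in the directions of \<open>S\<close> meet
      a point, so \<open>V\<^sub>S / (2 * s)\<close> is a budget for the sum of the heights;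
      dividing by \<open>\<sigma>\<^sub>S\<close> passes to noise units.\<close>
    define \<rho> where "\<rho> = V\<^sub>S / (2 * real s * \<sigma>\<^sub>S)"
    have \<rho>: "\<rho> > 0" using V\<^sub>S0 \<sigma>\<^sub>S0 \<open>s \<ge> 2\<close> by (simp add: \<rho>_def)
    define T where "T = Min {\<sigma>\<^sub>S * V\<^sub>S / (2 * real s) * sqrt (1 + ln (2 * \<sigma>\<^sub>S * real s * real n ^ s / V\<^sub>S)),
                 real n ^ s * \<sigma>\<^sub>S\<^sup>2, (V\<^sub>S / real s)\<^sup>2 + \<sigma>\<^sub>S\<^sup>2}"
    define M where "M = T / \<sigma>\<^sub>S\<^sup>2"
    have "T \<le> \<sigma>\<^sub>S * V\<^sub>S / (2 * real s) * sqrt (1 + ln (2 * \<sigma>\<^sub>S * real s * real n ^ s / V\<^sub>S))"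
      unfolding T_def by (intro Min_le) auto
    also have "\<sigma>\<^sub>S * V\<^sub>S / (2 * real s) = \<rho> * \<sigma>\<^sub>S\<^sup>2"
      using \<sigma>\<^sub>S0 by (simp add: \<rho>_def power2_eq_square)
    also have "2 * \<sigma>\<^sub>S * real s * real n ^ s / V\<^sub>S = real (n ^ s) / \<rho>"
      using \<sigma>\<^sub>S0 by (simp add: \<rho>_def)
    finally have M1: "M \<le> \<rho> * sqrt (1 + ln (real (n ^ s) / \<rho>))"
      using \<sigma>\<^sub>S0 by (simp add: M_def pos_divide_le_eq mult_ac)
    have "T \<le> real n ^ s * \<sigma>\<^sub>S\<^sup>2" unfolding T_def by (intro Min_le) auto
    then have M2: "M \<le> real (n ^ s)" using \<sigma>\<^sub>S0 by (simp add: M_def pos_divide_le_eq)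
    have "T \<le> (V\<^sub>S / real s)\<^sup>2 + \<sigma>\<^sub>S\<^sup>2" unfolding T_def by (intro Min_le) auto
    also have "\<dots> = (4 * \<rho>\<^sup>2 + 1) * \<sigma>\<^sub>S\<^sup>2"
      using \<sigma>\<^sub>S0 by (simp add: \<rho>_def power_divide power_mult_distrib algebra_simps)
    finally have M3: "M \<le> 4 * \<rho>\<^sup>2 + 1" using \<sigma>\<^sub>S0 by (simp add: M_def pos_divide_le_eq)
    have "ennreal (1 / 1048576 * A * T) \<le> ?R"
    proof (cases "M \<le> 16")
      case True
      then show ?thesis by (intro small) (simp add: M_def)
    next
      case False
      then obtain k m :: nat and \<alpha> where *: "m \<ge> 1" "\<alpha> \<ge> 0" "k * m \<le> n ^ s" "\<alpha>\<^sup>2 \<le> ln (real m / 8)"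
          "real k * \<alpha> \<le> \<rho>" "M \<le> 131072 * (real k * \<alpha>\<^sup>2)"
        using sparse_configuration[OF \<rho> M1 M2 M3] by (metis not_le)
      show ?thesis
      proof (rule reduce[where b = "real k * \<alpha>\<^sup>2 / 8"])
        show "T / \<sigma>\<^sub>S\<^sup>2 \<le> 1048576 * (real k * \<alpha>\<^sup>2 / 8)" using *(6) by (simp add: M_def)
        have "real k * \<alpha> * (2 * real s * \<sigma>\<^sub>S) \<le> V\<^sub>S"
          using *(5) \<sigma>\<^sub>S0 \<open>s \<ge> 2\<close> by (simp add: \<rho>_def pos_le_divide_eq)
        then have "real k * \<alpha> * (2 * real s * real 1 ^ (s - 1)) * \<sigma>\<^sub>S \<le> V\<^sub>S" by simp
        moreover have "k * m \<le> (n div 1) ^ s" "\<alpha>\<^sup>2 * real 1 ^ s \<le> ln (real m / 8)"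
          using *(3,4) by simp_all
        ultimately have "ennreal (\<sigma>\<^sup>2 * (real k * \<alpha>\<^sup>2 * real 1 ^ s) / 8) \<le> ?R"
          using *(1,2) by (intro cells) auto
        then show "ennreal (\<sigma>\<^sup>2 * (real k * \<alpha>\<^sup>2 / 8)) \<le> ?R" by simp
      qed
    qed
    then show "ennreal (1 / 1048576 * real n ^ (d - s) *
        Min {\<sigma>\<^sub>S * V\<^sub>S / (2 * real s) * sqrt (1 + ln (2 * \<sigma>\<^sub>S * real s * real n ^ s / V\<^sub>S)),
             real n ^ s * \<sigma>\<^sub>S\<^sup>2, (V\<^sub>S / real s)\<^sup>2 + \<sigma>\<^sub>S\<^sup>2}) \<le> ?R" by (simp only: A_def T_def)
  next
    assume "s = 1"
    define v where "v = V\<^sub>S / \<sigma>\<^sub>S"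
    have v: "v > 0" using V\<^sub>S0 \<sigma>\<^sub>S0 by (simp add: v_def)
    define T where "T = Min {(\<sigma>\<^sub>S\<^sup>2 * V\<^sub>S) powr (2/3) * real n powr (1/3), real n * \<sigma>\<^sub>S\<^sup>2, real n * V\<^sub>S\<^sup>2}"
    define M where "M = T / \<sigma>\<^sub>S\<^sup>2"
    have T0: "T \<ge> 0" unfolding T_def by (intro Min.boundedI) auto
    have "T \<le> (\<sigma>\<^sub>S\<^sup>2 * V\<^sub>S) powr (2/3) * real n powr (1/3)" unfolding T_def by (intro Min_le) auto
    \<comment> \<open>Cubing removes the fractional powers and yields the polynomial hypothesis of
      \<open>interval_configuration\<close>.\<close>
    then have "T ^ 3 \<le> ((\<sigma>\<^sub>S\<^sup>2 * V\<^sub>S) powr (2/3) * real n powr (1/3)) ^ 3"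
      using T0 by (intro power_mono)
    also have "\<dots> = (\<sigma>\<^sub>S\<^sup>2 * V\<^sub>S)\<^sup>2 * real n"
    proof -
      have "((\<sigma>\<^sub>S\<^sup>2 * V\<^sub>S) powr (2/3)) ^ 3 = (\<sigma>\<^sub>S\<^sup>2 * V\<^sub>S) powr (real 2)"
        using \<sigma>\<^sub>S0 V\<^sub>S0 by (subst powr_power) auto
      also have "\<dots> = (\<sigma>\<^sub>S\<^sup>2 * V\<^sub>S)\<^sup>2"
        using \<sigma>\<^sub>S0 V\<^sub>S0 by (subst powr_realpow) auto
      finally have "((\<sigma>\<^sub>S\<^sup>2 * V\<^sub>S) powr (2/3)) ^ 3 = (\<sigma>\<^sub>S\<^sup>2 * V\<^sub>S)\<^sup>2" .
      moreover have "(real n powr (1/3)) ^ 3 = real n"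
        using n by (subst powr_power) auto
      ultimately show ?thesis by (simp add: power_mult_distrib[of "_ powr _"])
    qed
    also have "\<dots> = v\<^sup>2 * real n * (\<sigma>\<^sub>S\<^sup>2) ^ 3"
      using \<sigma>\<^sub>S0 by (simp add: v_def power_divide power_mult_distrib power2_eq_square power3_eq_cube)
    finally have M1: "M ^ 3 \<le> v\<^sup>2 * real n"
      using \<sigma>\<^sub>S0 by (simp add: M_def power_divide pos_divide_le_eq)
    have "T \<le> real n * \<sigma>\<^sub>S\<^sup>2" unfolding T_def by (intro Min_le) auto
    then have M2: "M \<le> real n" using \<sigma>\<^sub>S0 by (simp add: M_def pos_divide_le_eq)
    have "ennreal (1 / 1048576 * A * T) \<le> ?R"
    proof (cases "M \<le> 64")
      case True
      then show ?thesis by (intro small) (simp add: M_def)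
    next
      case False
      then obtain h k :: nat where *: "h \<ge> 1" "k * 16 \<le> n div h" "real k \<le> v * sqrt (real h)" "M \<le> 128 * real k"
        using interval_configuration[OF v M2 M1] by (metis not_le)
      \<comment> \<open>The squared norm \<open>\<alpha>\<^sup>2 * h = 1/4\<close> lies below
        \<open>ln 2\<close>, and the two ends of an interval cost
        \<open>2 * \<alpha> = 1 / sqrt h\<close>, which matches the bound on
        \<open>k\<close>.\<close>
      define \<alpha> where "\<alpha> = 1 / (2 * sqrt (real h))"
      have \<alpha>: "\<alpha>\<^sup>2 * real h = 1 / 4" using *(1) by (simp add: \<alpha>_def power_divide power_mult_distrib)
      show ?thesis
      proof (rule reduce[where b = "real k / 32"])
        show "T / \<sigma>\<^sub>S\<^sup>2 \<le> 1048576 * (real k / 32)" using *(4) by (simp add: M_def)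
        have "real k * \<alpha> * 2 = real k / sqrt (real h)" by (simp add: \<alpha>_def)
        also have "\<dots> \<le> v" using *(1,3) by (simp add: pos_divide_le_eq)
        finally have "real k * \<alpha> * 2 * \<sigma>\<^sub>S \<le> V\<^sub>S" using \<sigma>\<^sub>S0 by (simp add: v_def pos_le_divide_eq)
        then have "real k * \<alpha> * (2 * real s * real h ^ (s - 1)) * \<sigma>\<^sub>S \<le> V\<^sub>S"
          using \<open>s = 1\<close> by simp
        moreover have "k * 16 \<le> (n div h) ^ s" "\<alpha>\<^sup>2 * real h ^ s \<le> ln (real 16 / 8)"
          using *(2) \<alpha> \<open>s = 1\<close> ln2_ge_two_thirds by simp_all
        moreover have "\<alpha> \<ge> 0" by (simp add: \<alpha>_def)
        ultimately have "ennreal (\<sigma>\<^sup>2 * (real k * \<alpha>\<^sup>2 * real h ^ s) / 8) \<le> ?R"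
          using *(1) by (intro cells[of h 16]) auto
        also have "\<sigma>\<^sup>2 * (real k * \<alpha>\<^sup>2 * real h ^ s) / 8 = \<sigma>\<^sup>2 * (real k / 32)"
          by (simp only: mult.assoc \<open>s = 1\<close> power_one_right \<alpha>)
        finally show "ennreal (\<sigma>\<^sup>2 * (real k / 32)) \<le> ?R" .
      qed
    qed
    then show "ennreal (1 / 1048576 * real n ^ (d - 1) *
        Min {(\<sigma>\<^sub>S\<^sup>2 * V\<^sub>S) powr (2/3) * real n powr (1/3), real n * \<sigma>\<^sub>S\<^sup>2, real n * V\<^sub>S\<^sup>2}) \<le> ?R"
      by (simp only: A_def T_def \<open>s = 1\<close>)
  }
qed simp

end
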